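(* Let $\alpha,\beta\in\mathbb{K}^*$ be roots of unity with $\alpha\beta\neq1$, and let $\underline{\mu}=(\mu_1,\mu_2,\mu_3,\mu_4)$ and $\underline{\lambda}=(\lambda_1,\lambda_2,\lambda_3,\lambda_4)$ be in $(\mathbb{K}^* )^4$. Then $\mathscr{V}_1(\underline{\mu})$ is isomorphic to $\mathscr{V}_1(\underline{\lambda})$ as $M_2(\alpha,\beta)$-modules if and only if $$\mu_1^{l_1}=\lambda_1^{l_1}\beta^{vl_1},\quad \mu_2^{l_2}=\lambda_2^{l_2}\beta^{-ul_2},\quad \mu_3=\lambda_3(\alpha\beta)^{-u}(\alpha^{-1}\beta)^v,\quad \mu_4=\lambda_4(\alpha^{-1}\beta)^v$$ holds for some integers $u,v$ such that $0\le u\le l_1-1$ and $0\le v\le l_2-1$.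
   Context: $\mathbb{K}$ is an algebraically closed field of arbitrary characteristic and $\mathbb{K}^*=\mathbb{K}\setminus\{0\}$; all modules are right modules. For a root of unity $\xi\in\mathbb{K}^*$, $\operatorname{ord}(\xi)$ is its order in the group $\mathbb{K}^*$. For $\alpha,\beta\in\mathbb{K}^*$, the two-parameter quantum matrix algebra $M_2(\alpha,\beta)$ is the associative unital $\mathbb{K}$-algebra generated by $X_{11},X_{12},X_{21},X_{22}$ subject to the relations $X_{12}X_{11}=\alpha X_{11}X_{12}$, $X_{22}X_{21}=\alpha X_{21}X_{22}$, $X_{21}X_{11}=\beta X_{11}X_{21}$, $X_{22}X_{12}=\beta X_{12}X_{22}$, $X_{21}X_{12}=\beta\alpha^{-1}X_{12}X_{21}$, $X_{22}X_{11}-X_{11}X_{22}=(\beta-\alpha^{-1})X_{12}X_{21}$. Set $l_1:=\operatorname{ord}(\alpha\beta)$ if $\operatorname{ord}(\beta)\mid\operatorname{ord}(\alpha\beta)\operatorname{ord}(\alpha\beta^{-1})$ and $l_1:=2\operatorname{ord}(\alpha\beta)$ otherwise; set $l_2:=\operatorname{ord}(\alpha\beta^{-1})$. $\mathscr{V}_1(\underline{\mu})$ is the $\mathbb{K}$-vector space with basis $\{e(a,b):0\le a\le l_1-1,\ 0\le b\le l_2-1\}$ and $M_2(\alpha,\beta)$-action (which does define a module structure) $$e(a,b)X_{11}=\mu_1\beta^b e(a\oplus1,b),$$ $$e(a,b)X_{12}=\begin{cases}\mu_2^{-1}\mu_3(\alpha^{-1}\beta)^b(\alpha\beta)^{-a}e(a,b-1)&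 b\neq0\\ \mu_2^{-1}\mu_3\beta^{al_2}(\alpha\beta)^{-a}e(a,l_2-1)& b=0\end{cases}$$ $$e(a,b)X_{21}=\begin{cases}\mu_2e(a,b+1)& b\neq l_2-1\\ \mu_2\beta^{-al_2}e(a,0)& b=l_2-1\end{cases}$$ $$e(a,b)X_{22}=\mu_1^{-1}\alpha^{-b}\left[\mu_4+\beta(\alpha\beta)^{-a}\mu_3\right]e(a\oplus(-1),b),$$ where $\oplus$ is addition modulo $l_1$. *)

theory Defs
  imports
    "HOL-Library.Poly_Mapping"
    "HOL-Computational_Algebra.Polynomial"
    "HOL-Algebra.QuotRing"
    "HOL-Algebra.Multiplicative_Group"
    "HOL-Algebra.Algebraic_Closure_Type"
begin

section \<open>Right modules over a ring\<close>

text \<open>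
  The library's \<^const>\<open>module\<close> is restricted to commutative rings of scalars.  As there, only
  the additive part of the underlying \<^typ>\<open>'v ring\<close> record is relevant.
\<close>

record ('r, 'v) rmodule = "'v ring" +
  ract :: "'v \<Rightarrow> 'r \<Rightarrow> 'v"

locale right_module = R?: ring R + M?: abelian_group M
  for R :: "('r, 'x) ring_scheme" (structure) and M :: "('r, 'v, 'y) rmodule_scheme" (structure) +
  assumes ract_closed: "\<lbrakk>x \<in> carrier M; r \<in> carrier R\<rbrakk> \<Longrightarrow> ract M x r \<in> carrier M"
    and ract_add_left: "\<lbrakk>x \<in> carrier M; y \<in> carrier M; r \<in> carrier R\<rbrakk>
      \<Longrightarrow> ract M (x \<oplus>\<^bsub>M\<^esub> y) r = ract M x r \<oplus>\<^bsub>M\<^esub> ract M y r"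
    and ract_add_right: "\<lbrakk>x \<in> carrier M; r \<in> carrier R; s \<in> carrier R\<rbrakk>
      \<Longrightarrow> ract M x (r \<oplus>\<^bsub>R\<^esub> s) = ract M x r \<oplus>\<^bsub>M\<^esub> ract M x s"
    and ract_mult: "\<lbrakk>x \<in> carrier M; r \<in> carrier R; s \<in> carrier R\<rbrakk>
      \<Longrightarrow> ract M x (r \<otimes>\<^bsub>R\<^esub> s) = ract M (ract M x r) s"
    and ract_one: "x \<in> carrier M \<Longrightarrow> ract M x \<one>\<^bsub>R\<^esub> = x"

definition rmodule_hom ::
    "('r, 'x) ring_scheme \<Rightarrow> ('r, 'v, 'y) rmodule_scheme \<Rightarrow> ('r, 'w, 'z) rmodule_scheme \<Rightarrow> ('v \<Rightarrow> 'w) set"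
  where "rmodule_hom R M N = {h. h \<in> carrier M \<rightarrow> carrier N
    \<and> (\<forall>x\<in>carrier M. \<forall>y\<in>carrier M. h (x \<oplus>\<^bsub>M\<^esub> y) = h x \<oplus>\<^bsub>N\<^esub> h y)
    \<and> (\<forall>x\<in>carrier M. \<forall>r\<in>carrier R. h (ract M x r) = ract N (h x) r)}"

definition rmodule_isomorphic ::
    "('r, 'x) ring_scheme \<Rightarrow> ('r, 'v, 'y) rmodule_scheme \<Rightarrow> ('r, 'w, 'z) rmodule_scheme \<Rightarrow> bool"
  where "rmodule_isomorphic R M N \<longleftrightarrow>
    (\<exists>h \<in> rmodule_hom R M N. bij_betw h (carrier M) (carrier N))"


section \<open>The free algebra on four generators\<close>

datatype gen = G11 | G12 | G21 | G22

text \<open>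
  Words are wrapped so that they form an (additively written) monoid; the convolution product on
  \<open>word \<Rightarrow>\<^sub>0 'k\<close> is then the multiplication of the free associative unital algebra.
\<close>

datatype word = Word (letters: "gen list")

instantiation word :: monoid_add
begin

definition zero_word :: word where "zero_word = Word []"

definition plus_word :: "word \<Rightarrow> word \<Rightarrow> word"
  where "plus_word v w = Word (letters v @ letters w)"

instance
  by standard (auto simp: zero_word_def plus_word_def)

end

definition fvar :: "gen \<Rightarrow> word \<Rightarrow>\<^sub>0 'k::comm_ring_1"
  where "fvar g = Poly_Mapping.single (Word [g]) 1"

definition fconst :: "'k \<Rightarrow> word \<Rightarrow>\<^sub>0 'k::comm_ring_1"
  where "fconst c = Poly_Mapping.single 0 c"


section \<open>Two-parameter quantum matrices\<close>

abbreviation free_alg :: "(word \<Rightarrow>\<^sub>0 'k::comm_ring_1) ring"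
  where "free_alg \<equiv> ring_of_type_algebra"

definition qmat_relators :: "'k::field \<Rightarrow> 'k \<Rightarrow> (word \<Rightarrow>\<^sub>0 'k) set"
  where "qmat_relators \<alpha> \<beta> =
    (let X11 = fvar G11; X12 = fvar G12; X21 = fvar G21; X22 = fvar G22 in
     {X12 * X11 - fconst \<alpha> * X11 * X12,
      X22 * X21 - fconst \<alpha> * X21 * X22,
      X21 * X11 - fconst \<beta> * X11 * X21,
      X22 * X12 - fconst \<beta> * X12 * X22,
      X21 * X12 - fconst (\<beta> * inverse \<alpha>) * X12 * X21,
      X22 * X11 - X11 * X22 - fconst (\<beta> - inverse \<alpha>) * X12 * X21})"

definition qmat :: "'k::field \<Rightarrow> 'k \<Rightarrow> (word \<Rightarrow>\<^sub>0 'k) set ring"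
  where "qmat \<alpha> \<beta> = free_alg Quot (Idl\<^bsub>free_alg\<^esub> (qmat_relators \<alpha> \<beta>))"


section \<open>The orders $l_1$ and $l_2$\<close>

definition root_of_unity :: "'k::field \<Rightarrow> bool"
  where "root_of_unity \<xi> \<longleftrightarrow> (\<exists>n>0. \<xi> ^ n = 1)"

definition ord_unit :: "'k::field \<Rightarrow> nat"
  where "ord_unit \<xi> = group.ord (Multiplicative_Group.mult_of ring_of_type_algebra) \<xi>"

definition l1 :: "'k::field \<Rightarrow> 'k \<Rightarrow> nat"
  where "l1 \<alpha> \<beta> =
    (if ord_unit \<beta> dvd ord_unit (\<alpha> * \<beta>) * ord_unit (\<alpha> * inverse \<beta>)
     then ord_unit (\<alpha> * \<beta>) else 2 * ord_unit (\<alpha> * \<beta>))"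

definition l2 :: "'k::field \<Rightarrow> 'k \<Rightarrow> nat"
  where "l2 \<alpha> \<beta> = ord_unit (\<alpha> * inverse \<beta>)"


section \<open>The modules $V_1(\mu)$\<close>

definition scale :: "'k \<Rightarrow> ('i \<Rightarrow>\<^sub>0 'k) \<Rightarrow> ('i \<Rightarrow>\<^sub>0 'k::field)"
  where "scale c v = Poly_Mapping.map ((*) c) v"

definition lin_ext :: "('i \<Rightarrow> ('j \<Rightarrow>\<^sub>0 'k)) \<Rightarrow> ('i \<Rightarrow>\<^sub>0 'k) \<Rightarrow> ('j \<Rightarrow>\<^sub>0 'k::field)"
  where "lin_ext f v = (\<Sum>i\<in>Poly_Mapping.keys v. scale (Poly_Mapping.lookup v i) (f i))"

definition ebasis :: "nat \<Rightarrow> nat \<Rightarrow> (nat \<times> nat \<Rightarrow>\<^sub>0 'k::field)"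
  where "ebasis a b = Poly_Mapping.single (a, b) 1"

type_synonym 'k param = "'k \<times> 'k \<times> 'k \<times> 'k"

text \<open>
  The image of \<open>e(a,b)\<close> under a generator, meaningful only for \<open>a < l\<^sub>1\<close> and \<open>b < l\<^sub>2\<close>;
  \<open>(a + (l\<^sub>1 - 1)) mod l\<^sub>1\<close> is \<open>a \<oplus> (-1)\<close>.
\<close>

fun basis_act :: "'k::field \<Rightarrow> 'k \<Rightarrow> 'k param \<Rightarrow> gen \<Rightarrow> nat \<times> nat \<Rightarrow> (nat \<times> nat \<Rightarrow>\<^sub>0 'k)" where
  "basis_act \<alpha> \<beta> (\<mu>1, \<mu>2, \<mu>3, \<mu>4) G11 (a, b) =
     scale (\<mu>1 * \<beta> ^ b) (ebasis ((a + 1) mod l1 \<alpha> \<beta>) b)"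
| "basis_act \<alpha> \<beta> (\<mu>1, \<mu>2, \<mu>3, \<mu>4) G12 (a, b) =
     (if b \<noteq> 0
      then scale (inverse \<mu>2 * \<mu>3 * (inverse \<alpha> * \<beta>) ^ b * inverse (\<alpha> * \<beta>) ^ a) (ebasis a (b - 1))
      else scale (inverse \<mu>2 * \<mu>3 * \<beta> ^ (a * l2 \<alpha> \<beta>) * inverse (\<alpha> * \<beta>) ^ a) (ebasis a (l2 \<alpha> \<beta> - 1)))"
| "basis_act \<alpha> \<beta> (\<mu>1, \<mu>2, \<mu>3, \<mu>4) G21 (a, b) =
     (if b \<noteq> l2 \<alpha> \<beta> - 1
      then scale \<mu>2 (ebasis a (b + 1))
      else scale (\<mu>2 * inverse \<beta> ^ (a * l2 \<alpha> \<beta>)) (ebasis a 0))"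
| "basis_act \<alpha> \<beta> (\<mu>1, \<mu>2, \<mu>3, \<mu>4) G22 (a, b) =
     scale (inverse \<mu>1 * inverse \<alpha> ^ b * (\<mu>4 + \<beta> * inverse (\<alpha> * \<beta>) ^ a * \<mu>3))
       (ebasis ((a + (l1 \<alpha> \<beta> - 1)) mod l1 \<alpha> \<beta>) b)"

definition gen_act :: "'k::field \<Rightarrow> 'k \<Rightarrow> 'k param \<Rightarrow> gen \<Rightarrow> (nat \<times> nat \<Rightarrow>\<^sub>0 'k) \<Rightarrow> (nat \<times> nat \<Rightarrow>\<^sub>0 'k)"
  where "gen_act \<alpha> \<beta> \<mu> g = lin_ext (basis_act \<alpha> \<beta> \<mu> g)"

text \<open>Right action: the leftmost letter of a word acts first.\<close>

definition word_act :: "'k::field \<Rightarrow> 'k \<Rightarrow> 'k param \<Rightarrow> word \<Rightarrow> (nat \<times> nat \<Rightarrow>\<^sub>0 'k) \<Rightarrow> (nat \<times> nat \<Rightarrow>\<^sub>0 'k)"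
  where "word_act \<alpha> \<beta> \<mu> w = fold (gen_act \<alpha> \<beta> \<mu>) (letters w)"

definition free_act :: "'k::field \<Rightarrow> 'k \<Rightarrow> 'k param \<Rightarrow> (nat \<times> nat \<Rightarrow>\<^sub>0 'k) \<Rightarrow> (word \<Rightarrow>\<^sub>0 'k) \<Rightarrow> (nat \<times> nat \<Rightarrow>\<^sub>0 'k)"
  where "free_act \<alpha> \<beta> \<mu> v f = lin_ext (\<lambda>w. word_act \<alpha> \<beta> \<mu> w v) f"

text \<open>
  A coset acts by the common action of its representatives.
  Well-definedness is \<open>V1_ract_coset\<close> and \<open>V1_right_module\<close> below.
\<close>

definition V1 :: "'k::field \<Rightarrow> 'k \<Rightarrow> 'k param \<Rightarrow> ((word \<Rightarrow>\<^sub>0 'k) set, nat \<times> nat \<Rightarrow>\<^sub>0 'k) rmodule"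
  where "V1 \<alpha> \<beta> \<mu> =
    \<lparr>carrier = {v. Poly_Mapping.keys v \<subseteq> {0..<l1 \<alpha> \<beta>} \<times> {0..<l2 \<alpha> \<beta>}},
     monoid.mult = undefined, one = undefined,
     ring.zero = 0, add = (+),
     ract = (\<lambda>v C. the_elem (free_act \<alpha> \<beta> \<mu> v ` C))\<rparr>"


section \<open>Well-definedness\<close>

lemma lookup_scale [simp]: "Poly_Mapping.lookup (scale c v) i = c * Poly_Mapping.lookup v i"
  by (simp add: scale_def Poly_Mapping.map.rep_eq when_def)

lemma scale_single [simp]: "scale c (Poly_Mapping.single i d) = Poly_Mapping.single i (c * d)"
  by (rule poly_mapping_eqI) (simp add: lookup_single when_def)

lemma scale_simps [simp]:
  "scale c 0 = 0" "scale 0 v = 0" "scale 1 v = v" "scale c (scale d v) = scale (c * d) v"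
  by (rule poly_mapping_eqI, simp add: algebra_simps)+

lemma scale_add_right: "scale c (v + w) = scale c v + scale c w"
  by (rule poly_mapping_eqI) (simp add: lookup_add algebra_simps)

lemma scale_add_left: "scale (c + d) v = scale c v + scale d v"
  by (rule poly_mapping_eqI) (simp add: lookup_add algebra_simps)

lemma scale_diff_right: "scale c (v - w) = scale c v - scale c w"
  by (rule poly_mapping_eqI) (simp add: lookup_minus algebra_simps)

lemma scale_diff_left: "scale (c - d) v = scale c v - scale d v"
  by (rule poly_mapping_eqI) (simp add: lookup_minus algebra_simps)

lemma scale_sum: "scale c (\<Sum>i\<in>A. f i) = (\<Sum>i\<in>A. scale c (f i))"
  by (induction A rule: infinite_finite_induct) (auto simp: scale_add_right)

lemma poly_mapping_add_induct [case_names zero single add]: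
  fixes v :: "'i \<Rightarrow>\<^sub>0 'k::field"
  assumes "P 0" "\<And>i c. P (Poly_Mapping.single i c)" "\<And>v w. P v \<Longrightarrow> P w \<Longrightarrow> P (v + w)"
  shows "P v"
proof -
  have "P (\<Sum>i\<in>A. Poly_Mapping.single i (c i))" if "finite A" for A :: "'i set" and c
    using that by (induction A rule: finite_induct) (auto intro: assms)
  moreover have "v = (\<Sum>i\<in>Poly_Mapping.keys v. Poly_Mapping.single i (Poly_Mapping.lookup v i))"
    by (rule poly_mapping_eqI)
      (auto simp: lookup_sum lookup_single when_def in_keys_iff if_distrib sum.delta cong: if_cong)
  ultimately show ?thesis
    by (metis finite_keys)
qed

lemma lin_ext_superset:
  assumes "finite A" "Poly_Mapping.keys v \<subseteq> A"
  shows "lin_ext f v = (\<Sum>i\<in>A. scale (Poly_Mapping.lookup v i) (f i))"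
  unfolding lin_ext_def
  by (rule sum.mono_neutral_left) (use assms in \<open>auto simp: in_keys_iff\<close>)

lemma lin_ext_zero [simp]: "lin_ext f 0 = 0"
  by (simp add: lin_ext_def)

lemma lin_ext_single [simp]: "lin_ext f (Poly_Mapping.single i c) = scale c (f i)"
  by (simp add: lin_ext_def)

lemma lin_ext_add: "lin_ext f (v + w) = lin_ext f v + lin_ext f w"
proof -
  let ?A = "Poly_Mapping.keys v \<union> Poly_Mapping.keys w"
  have "Poly_Mapping.keys (v + w) \<subseteq> ?A"
    by (rule Poly_Mapping.keys_add)
  then show ?thesis
    by (simp add: lin_ext_superset[of ?A] lookup_add scale_add_left sum.distrib)
qed

lemma lin_ext_uminus: "lin_ext f (- v) = - lin_ext f v"
  using lin_ext_add[of f v "- v"] by (simp add: add_eq_0_iff)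

lemma lin_ext_diff: "lin_ext f (v - w) = lin_ext f v - lin_ext f w"
  using lin_ext_add[of f v "- w"] by (simp add: lin_ext_uminus)

lemma lin_ext_scale: "lin_ext f (scale c v) = scale c (lin_ext f v)"
  by (induction v rule: poly_mapping_add_induct) (simp_all add: lin_ext_add scale_add_right)

lemma lin_ext_fun_add: "lin_ext (\<lambda>i. f i + g i) v = lin_ext f v + lin_ext g v"
  by (simp add: lin_ext_def scale_add_right sum.distrib)

lemma lin_ext_fun_scale: "lin_ext (\<lambda>i. scale c (f i)) v = scale c (lin_ext f v)"
  by (simp add: lin_ext_def scale_sum mult.commute)

lemma word_act_simps [simp]:
  "word_act \<alpha> \<beta> \<mu> 0 v = v"
  "word_act \<alpha> \<beta> \<mu> (Word []) v = v"
  "word_act \<alpha> \<beta> \<mu> (Word (g # gs)) v = word_act \<alpha> \<beta> \<mu> (Word gs) (gen_act \<alpha> \<beta> \<mu> g v)"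
  by (simp_all add: word_act_def zero_word_def)

lemma word_act_plus: "word_act \<alpha> \<beta> \<mu> (w + w') v = word_act \<alpha> \<beta> \<mu> w' (word_act \<alpha> \<beta> \<mu> w v)"
  by (simp add: word_act_def plus_word_def)

lemma word_act_zero: "word_act \<alpha> \<beta> \<mu> w 0 = 0"
proof (cases w)
  case (Word gs)
  then show ?thesis
    by (induction gs arbitrary: w) (simp_all add: gen_act_def)
qed

lemma word_act_add: "word_act \<alpha> \<beta> \<mu> w (v + v') = word_act \<alpha> \<beta> \<mu> w v + word_act \<alpha> \<beta> \<mu> w v'"
proof (cases w)
  case (Word gs)
  then show ?thesis
    by (induction gs arbitrary: v v' w) (simp_all add: gen_act_def lin_ext_add)
qed

lemma word_act_scale: "word_act \<alpha> \<beta> \<mu> w (scale c v) = scale c (word_act \<alpha> \<beta> \<mu> w v)"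
proof (cases w)
  case (Word gs)
  then show ?thesis
    by (induction gs arbitrary: v w) (simp_all add: gen_act_def lin_ext_scale)
qed

lemma free_act_zero_left [simp]: "free_act \<alpha> \<beta> \<mu> 0 f = 0"
  by (simp add: free_act_def word_act_zero lin_ext_def)

lemma free_act_zero_right [simp]: "free_act \<alpha> \<beta> \<mu> v 0 = 0"
  by (simp add: free_act_def)

lemma free_act_add_left: "free_act \<alpha> \<beta> \<mu> (v + v') f = free_act \<alpha> \<beta> \<mu> v f + free_act \<alpha> \<beta> \<mu> v' f"
  by (simp add: free_act_def word_act_add lin_ext_fun_add)

lemma free_act_scale_left: "free_act \<alpha> \<beta> \<mu> (scale c v) f = scale c (free_act \<alpha> \<beta> \<mu> v f)"
  by (simp add: free_act_def word_act_scale lin_ext_fun_scale)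

lemma free_act_add_right: "free_act \<alpha> \<beta> \<mu> v (f + g) = free_act \<alpha> \<beta> \<mu> v f + free_act \<alpha> \<beta> \<mu> v g"
  by (simp add: free_act_def lin_ext_add)

lemma free_act_diff_right: "free_act \<alpha> \<beta> \<mu> v (f - g) = free_act \<alpha> \<beta> \<mu> v f - free_act \<alpha> \<beta> \<mu> v g"
  by (simp add: free_act_def lin_ext_diff)

lemma free_act_single: "free_act \<alpha> \<beta> \<mu> v (Poly_Mapping.single w c) = scale c (word_act \<alpha> \<beta> \<mu> w v)"
  by (simp add: free_act_def)

lemma free_act_mult: "free_act \<alpha> \<beta> \<mu> v (f * g) = free_act \<alpha> \<beta> \<mu> (free_act \<alpha> \<beta> \<mu> v f) g"
proof (induction f rule: poly_mapping_add_induct)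
  case (single w c)
  show ?case
    by (induction g rule: poly_mapping_add_induct)
      (simp_all add: distrib_left free_act_add_right mult_single free_act_single word_act_plus
        word_act_scale mult.commute)
qed (simp_all add: distrib_right free_act_add_right free_act_add_left)

lemma free_act_fvar [simp]: "free_act \<alpha> \<beta> \<mu> v (fvar g) = gen_act \<alpha> \<beta> \<mu> g v"
  by (simp add: fvar_def free_act_single)

lemma free_act_fconst [simp]: "free_act \<alpha> \<beta> \<mu> v (fconst c) = scale c v"
  by (simp add: fconst_def free_act_single)

lemma free_act_one [simp]: "free_act \<alpha> \<beta> \<mu> v 1 = v"
  by (metis free_act_fconst fconst_def single_one scale_simps(3))

lemma ring_free_alg: "ring (free_alg :: (word \<Rightarrow>\<^sub>0 'k::comm_ring_1) ring)"
proof -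
  have "\<exists>y. x + y = 0" for x :: "word \<Rightarrow>\<^sub>0 'k"
    using add.right_inverse by blast
  then show ?thesis
    unfolding ring_of_type_algebra_def using add.right_inverse
    by unfold_locales (auto simp: algebra_simps Units_def)
qed

lemma pow_ring_of_type_algebra: "x [^]\<^bsub>ring_of_type_algebra\<^esub> (n::nat) = (x::'k::field) ^ n"
  by (induction n) (simp_all add: ring_of_type_algebra_def nat_pow_def mult.commute)

lemma power_eq_1_iff_ord_unit:
  fixes \<xi> :: "'k::field"
  assumes "\<xi> \<noteq> 0"
  shows "\<xi> ^ n = 1 \<longleftrightarrow> ord_unit \<xi> dvd n"
proof -
  interpret G: group "Multiplicative_Group.mult_of (ring_of_type_algebra :: 'k ring)"
    by (intro field.field_mult_group field_from_type_algebra)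
  have "\<xi> \<in> carrier (Multiplicative_Group.mult_of ring_of_type_algebra)"
    using assms by (simp add: ring_of_type_algebra_def)
  from G.pow_eq_id[OF this, of n] show ?thesis
    unfolding Multiplicative_Group.nat_pow_mult_of pow_ring_of_type_algebra ord_unit_def
    by (simp add: ring_of_type_algebra_def)
qed

lemma root_of_unity_mult:
  assumes "root_of_unity \<xi>" "root_of_unity \<eta>"
  shows "root_of_unity (\<xi> * \<eta>)"
proof -
  obtain m n where "m > 0" "n > 0" "\<xi> ^ m = 1" "\<eta> ^ n = 1"
    using assms by (auto simp: root_of_unity_def)
  moreover have "(\<xi> * \<eta>) ^ (m * n) = (\<xi> ^ m) ^ n * (\<eta> ^ n) ^ m"
    by (simp add: power_mult_distrib mult.commute flip: power_mult)
  ultimately have "(\<xi> * \<eta>) ^ (m * n) = 1"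
    by simp
  then show ?thesis
    using \<open>m > 0\<close> \<open>n > 0\<close> unfolding root_of_unity_def by (intro exI[of _ "m * n"]) simp
qed

lemma root_of_unity_inverse: "root_of_unity \<xi> \<Longrightarrow> root_of_unity (inverse \<xi>)"
  by (auto simp: root_of_unity_def power_inverse)

lemma root_of_unity_nonzero: "root_of_unity \<xi> \<Longrightarrow> \<xi> \<noteq> 0"
  by (auto simp: root_of_unity_def power_0_left)

lemma ord_unit_pos: "root_of_unity \<xi> \<Longrightarrow> ord_unit \<xi> > 0"
  using power_eq_1_iff_ord_unit[of \<xi>] root_of_unity_nonzero[of \<xi>]
  by (auto simp: root_of_unity_def intro!: Nat.gr0I)

lemma l1_pos: "root_of_unity \<alpha> \<Longrightarrow> root_of_unity \<beta> \<Longrightarrow> l1 \<alpha> \<beta> > 0"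
  by (simp add: l1_def ord_unit_pos root_of_unity_mult)

lemma l2_pos: "root_of_unity \<alpha> \<Longrightarrow> root_of_unity \<beta> \<Longrightarrow> l2 \<alpha> \<beta> > 0"
  by (simp add: l2_def ord_unit_pos root_of_unity_mult root_of_unity_inverse)

lemma power_l1:
  assumes "\<alpha> \<noteq> 0" "\<beta> \<noteq> 0"
  shows "(\<alpha> * \<beta>) ^ l1 \<alpha> \<beta> = 1"
  using assms by (simp add: power_eq_1_iff_ord_unit l1_def)

lemma power_l2:
  assumes "\<alpha> \<noteq> 0" "\<beta> \<noteq> 0"
  shows "\<alpha> ^ l2 \<alpha> \<beta> = \<beta> ^ l2 \<alpha> \<beta>"
proof -
  have "(\<alpha> * inverse \<beta>) ^ l2 \<alpha> \<beta> = 1"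
    using assms by (subst power_eq_1_iff_ord_unit) (auto simp: l2_def)
  then show ?thesis
    using assms by (simp add: power_mult_distrib power_inverse field_simps)
qed

lemma power_l1_l2:
  assumes "\<alpha> \<noteq> 0" "\<beta> \<noteq> 0"
  shows "\<beta> ^ (l1 \<alpha> \<beta> * l2 \<alpha> \<beta>) = 1"
proof (cases "ord_unit \<beta> dvd ord_unit (\<alpha> * \<beta>) * ord_unit (\<alpha> * inverse \<beta>)")
  case True
  then show ?thesis
    using assms by (simp add: power_eq_1_iff_ord_unit l1_def l2_def)
next
  case False
  define m where "m = ord_unit (\<alpha> * \<beta>)"
  have m: "(\<alpha> * \<beta>) ^ m = 1"
    using assms by (simp add: power_eq_1_iff_ord_unit m_def)
  have "l1 \<alpha> \<beta> * l2 \<alpha> \<beta> = l2 \<alpha> \<beta> * m + l2 \<alpha> \<beta> * m"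
    using False by (simp add: l1_def m_def)
  then have "\<beta> ^ (l1 \<alpha> \<beta> * l2 \<alpha> \<beta>) = (\<beta> ^ l2 \<alpha> \<beta> * \<beta> ^ l2 \<alpha> \<beta>) ^ m"
    by (simp only: power_add power_mult power_mult_distrib)
  also have "\<dots> = (\<alpha> ^ l2 \<alpha> \<beta> * \<beta> ^ l2 \<alpha> \<beta>) ^ m"
    using power_l2[OF assms] by simp
  also have "\<dots> = ((\<alpha> * \<beta>) ^ m) ^ l2 \<alpha> \<beta>"
    by (simp add: mult.commute flip: power_mult power_mult_distrib)
  finally show ?thesis
    by (simp add: m)
qed

lemma mod_cycle:
  fixes a l :: nat
  assumes "a < l"
  shows "((a + 1) mod l + (l - 1)) mod l = a" "((a + (l - 1)) mod l + 1) mod l = a"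
  using assms unfolding mod_add_left_eq by simp_all

lemma power_mod_cycle:
  fixes x :: "'k::field"
  assumes "x ^ l = 1" "l > 0"
  shows "x ^ (a mod l) = x ^ a"
proof -
  have "x ^ a = x ^ (l * (a div l) + a mod l)"
    by simp
  also have "\<dots> = (x ^ l) ^ (a div l) * x ^ (a mod l)"
    by (simp only: power_add power_mult)
  finally show ?thesis
    using assms by simp
qed

lemma power_pred_cycle:
  fixes x :: "'k::field"
  assumes "x ^ l = 1" "l > 0"
  shows "x ^ ((a + (l - 1)) mod l) = x ^ a * inverse x"
proof -
  have "x * x ^ (l - 1) = 1"
    using assms by (metis Suc_pred' power_Suc)
  then have "x ^ (l - 1) = inverse x"
    by (metis inverse_unique)
  then show ?thesis
    unfolding power_mod_cycle[OF assms] power_add by simp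
qed

lemma gen_act_scale: "gen_act \<alpha> \<beta> \<mu> g (scale c v) = scale c (gen_act \<alpha> \<beta> \<mu> g v)"
  by (simp add: gen_act_def lin_ext_scale)

lemma gen_act_ebasis: "gen_act \<alpha> \<beta> \<mu> g (ebasis a b) = basis_act \<alpha> \<beta> \<mu> g (a, b)"
  by (simp add: gen_act_def ebasis_def)

lemma relators_act_ebasis:
  fixes \<alpha> \<beta> :: "'k::field"
  assumes roots: "root_of_unity \<alpha>" "root_of_unity \<beta>"
    and \<mu>: "\<mu>1 \<noteq> 0" "\<mu>2 \<noteq> 0"
    and ab: "a < l1 \<alpha> \<beta>" "b < l2 \<alpha> \<beta>"
    and r: "r \<in> qmat_relators \<alpha> \<beta>"
  shows "free_act \<alpha> \<beta> (\<mu>1, \<mu>2, \<mu>3, \<mu>4) (ebasis a b) r = 0"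
proof -
  have nz: "\<alpha> \<noteq> 0" "\<beta> \<noteq> 0"
    using roots by (auto dest: root_of_unity_nonzero)
  note l1 = l1_pos[OF roots]
  have i: "inverse (\<alpha> * \<beta>) ^ l1 \<alpha> \<beta> = 1"
    using power_l1[OF nz] by (metis inverse_1 power_inverse)
  have q: "(\<beta> ^ l2 \<alpha> \<beta>) ^ l1 \<alpha> \<beta> = 1"
    using power_l1_l2[OF nz] by (simp add: mult.commute flip: power_mult)
  have qi: "(inverse \<beta> ^ l2 \<alpha> \<beta>) ^ l1 \<alpha> \<beta> = 1"
    using q by (simp add: power_inverse)
  obtain L where L: "l2 \<alpha> \<beta> = Suc L"
    using l2_pos[OF roots] gr0_implies_Suc by blast
  have \<alpha>L: "\<alpha> ^ L = \<beta> * \<beta> ^ L / \<alpha>"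
    using power_l2[OF nz] nz L by (simp add: field_simps)
  define s where "s = (a + 1) mod l1 \<alpha> \<beta>"
  define p where "p = (a + (l1 \<alpha> \<beta> - 1)) mod l1 \<alpha> \<beta>"
  have i_s: "inverse (\<alpha> * \<beta>) ^ s = inverse (\<alpha> * \<beta>) ^ a * inverse (\<alpha> * \<beta>)"
    by (simp only: s_def power_mod_cycle[OF i l1] power_add power_one_right)
  have i_p: "inverse (\<alpha> * \<beta>) ^ p = inverse (\<alpha> * \<beta>) ^ a * (\<alpha> * \<beta>)"
    by (simp only: p_def power_pred_cycle[OF i l1] inverse_inverse_eq)
  have "(\<beta> ^ l2 \<alpha> \<beta>) ^ s = (\<beta> ^ l2 \<alpha> \<beta>) ^ a * \<beta> ^ l2 \<alpha> \<beta>"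
    "(inverse \<beta> ^ l2 \<alpha> \<beta>) ^ s = (inverse \<beta> ^ l2 \<alpha> \<beta>) ^ a * inverse \<beta> ^ l2 \<alpha> \<beta>"
    unfolding s_def power_mod_cycle[OF q l1] power_mod_cycle[OF qi l1] power_add power_one_right
    by (rule refl)+
  moreover have "(\<beta> ^ l2 \<alpha> \<beta>) ^ p = (\<beta> ^ l2 \<alpha> \<beta>) ^ a * inverse (\<beta> ^ l2 \<alpha> \<beta>)"
    "(inverse \<beta> ^ l2 \<alpha> \<beta>) ^ p = (inverse \<beta> ^ l2 \<alpha> \<beta>) ^ a * inverse (inverse \<beta> ^ l2 \<alpha> \<beta>)"
    unfolding p_def power_pred_cycle[OF q l1] power_pred_cycle[OF qi l1]
    by (rule refl)+
  ultimately have q_sp: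
    "\<beta> ^ (s * Suc L) = \<beta> ^ (a * Suc L) * (\<beta> * \<beta> ^ L)"
    "\<beta> ^ (p * Suc L) = \<beta> ^ (a * Suc L) * inverse (\<beta> * \<beta> ^ L)"
    "inverse \<beta> ^ (s * Suc L) = inverse \<beta> ^ (a * Suc L) * (inverse \<beta> * inverse \<beta> ^ L)"
    "inverse \<beta> ^ (p * Suc L) = inverse \<beta> ^ (a * Suc L) * inverse (inverse \<beta> * inverse \<beta> ^ L)"
    unfolding mult.commute[of _ "Suc L"] power_mult unfolding L power_Suc by blast+
  define I where "I = inverse (\<alpha> * \<beta>) ^ a"
  define Q where "Q = \<beta> ^ (a * Suc L)"
  have Qi: "inverse \<beta> ^ (a * Suc L) = inverse Q" and Q0: "Q \<noteq> 0"
    using nz by (simp_all add: Q_def power_inverse)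
  have cyc: "(s + (l1 \<alpha> \<beta> - 1)) mod l1 \<alpha> \<beta> = a" "(p + 1) mod l1 \<alpha> \<beta> = a"
    using mod_cycle[OF ab(1)] by (simp_all add: s_def p_def)
  have q_sp':
    "\<beta> ^ (s * Suc L) = Q * (\<beta> * \<beta> ^ L)"
    "\<beta> ^ (p * Suc L) = Q * inverse (\<beta> * \<beta> ^ L)"
    "inverse \<beta> ^ (s * Suc L) = inverse Q * inverse (\<beta> * \<beta> ^ L)"
    "inverse \<beta> ^ (p * Suc L) = inverse Q * (\<beta> * \<beta> ^ L)"
    "\<beta> ^ (a * Suc L) = Q" "inverse \<beta> ^ (a * Suc L) = inverse Q"
    unfolding q_sp Qi by (simp_all add: Q_def power_inverse)
  have scale_eq: "scale c v - scale d v = 0" if "c = d" for c d :: 'k and v :: "nat \<times> nat \<Rightarrow>\<^sub>0 'k"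
    using that by simp
  have scale_eq3: "scale c v - scale d v - scale d' v = 0" if "c - d = d'"
    for c d d' :: 'k and v :: "nat \<times> nat \<Rightarrow>\<^sub>0 'k"
    using that by (simp flip: scale_diff_left)
  note acts = free_act_diff_right free_act_mult free_act_fvar free_act_fconst gen_act_scale
    gen_act_ebasis basis_act.simps s_def[symmetric] p_def[symmetric] cyc L diff_Suc_1
    scale_simps(4) i_s i_p I_def[symmetric] q_sp'
  consider "b = 0" "L = 0" | "b = 0" "0 \<noteq> L" "L \<noteq> 0"
    | b' where "b = Suc b'" "L = Suc b'" | b' where "b = Suc b'" "Suc b' \<noteq> L" "b' \<noteq> L"
    using ab L by (cases b) auto
  then have "\<forall>r\<in>qmat_relators \<alpha> \<beta>. free_act \<alpha> \<beta> (\<mu>1, \<mu>2, \<mu>3, \<mu>4) (ebasis a b) r = 0"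
  proof cases
    case 1
    then have "\<alpha> = \<beta>"
      using \<alpha>L nz by (simp add: field_simps)
    then have *: "\<alpha> ^ n = \<beta> ^ n" for n
      by simp
    note * = * \<open>\<alpha> = \<beta>\<close>
    show ?thesis
      unfolding qmat_relators_def Let_def ball_simps
      apply (simp only: 1 acts q_sp'[unfolded 1] not_False_eq_True not_True_eq_False if_True if_False simp_thms nat.distinct n_not_Suc_n)
      apply (simp only: 1 if_cancel Suc_eq_plus1[symmetric] diff_Suc_1 not_False_eq_True not_True_eq_False if_True if_False simp_thms nat.distinct n_not_Suc_n nat.inject scale_simps(4))?
      apply (intro conjI; (rule scale_eq scale_eq3, use nz \<mu> Q0 in \<open>simp add: * field_simps\<close>))
      done
  next
    case 2
    note * = \<alpha>L
    show ?thesis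
      unfolding qmat_relators_def Let_def ball_simps
      apply (simp only: 2 acts q_sp'[unfolded 2] not_False_eq_True not_True_eq_False if_True if_False simp_thms nat.distinct n_not_Suc_n)
      apply (simp only: 2 Suc_eq_plus1[symmetric] diff_Suc_1 not_False_eq_True not_True_eq_False if_True if_False simp_thms nat.distinct n_not_Suc_n nat.inject scale_simps(4))?
      apply (intro conjI; (rule scale_eq scale_eq3, use nz \<mu> Q0 in \<open>simp add: * field_simps\<close>))
      done
  next
    case 3
    then have *: "\<alpha> ^ b' = \<beta> * \<beta> * \<beta> ^ b' / (\<alpha> * \<alpha>)"
      using \<alpha>L nz by (simp add: field_simps)
    show ?thesis
      unfolding qmat_relators_def Let_def ball_simps
      apply (simp only: 3 acts q_sp'[unfolded 3] not_False_eq_True not_True_eq_False if_True if_False simp_thms nat.distinct n_not_Suc_n)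
      apply (simp only: 3 Suc_eq_plus1[symmetric] diff_Suc_1 not_False_eq_True not_True_eq_False if_True if_False simp_thms nat.distinct n_not_Suc_n nat.inject scale_simps(4))?
      apply (intro conjI; (rule scale_eq scale_eq3, use nz \<mu> Q0 in \<open>simp add: * field_simps\<close>))
      done
  next
    case 4
    note * = refl
    show ?thesis
      unfolding qmat_relators_def Let_def ball_simps
      apply (simp only: 4 acts q_sp'[unfolded 4] not_False_eq_True not_True_eq_False if_True if_False simp_thms nat.distinct n_not_Suc_n)
      apply (simp only: 4 Suc_eq_plus1[symmetric] diff_Suc_1 not_False_eq_True not_True_eq_False if_True if_False simp_thms nat.distinct n_not_Suc_n nat.inject scale_simps(4))?
      apply (intro conjI; (rule scale_eq scale_eq3, use nz \<mu> Q0 in \<open>simp add: * field_simps\<close>))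
      done
  qed
  then show ?thesis
    using r by blast
qed

lemma keys_scale: "Poly_Mapping.keys (scale c v) \<subseteq> Poly_Mapping.keys v"
  by (auto simp: in_keys_iff)

lemma ring_of_type_algebra_sel [simp]:
  "carrier ring_of_type_algebra = UNIV"
  "x \<otimes>\<^bsub>ring_of_type_algebra\<^esub> y = x * y"
  "x \<oplus>\<^bsub>ring_of_type_algebra\<^esub> y = x + y"
  "\<one>\<^bsub>ring_of_type_algebra\<^esub> = 1"
  "\<zero>\<^bsub>ring_of_type_algebra\<^esub> = 0"
  by (simp_all add: ring_of_type_algebra_def)

lemma carrier_V1:
  "carrier (V1 \<alpha> \<beta> \<mu>) = {v. Poly_Mapping.keys v \<subseteq> {0..<l1 \<alpha> \<beta>} \<times> {0..<l2 \<alpha> \<beta>}}"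
  by (simp add: V1_def)

lemma V1_sel [simp]: "v \<oplus>\<^bsub>V1 \<alpha> \<beta> \<mu>\<^esub> w = v + w" "\<zero>\<^bsub>V1 \<alpha> \<beta> \<mu>\<^esub> = 0"
  by (simp_all add: V1_def)

lemma carrier_V1_add:
  "v \<in> carrier (V1 \<alpha> \<beta> \<mu>) \<Longrightarrow> w \<in> carrier (V1 \<alpha> \<beta> \<mu>) \<Longrightarrow> v + w \<in> carrier (V1 \<alpha> \<beta> \<mu>)"
  unfolding carrier_V1 using Poly_Mapping.keys_add[of v w] by auto

lemma carrier_V1_zero: "0 \<in> carrier (V1 \<alpha> \<beta> \<mu>)"
  by (simp add: carrier_V1)

lemma carrier_V1_scale: "v \<in> carrier (V1 \<alpha> \<beta> \<mu>) \<Longrightarrow> scale c v \<in> carrier (V1 \<alpha> \<beta> \<mu>)"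
  unfolding carrier_V1 using keys_scale[of c v] by auto

lemma sum_closed_set:
  assumes "0 \<in> S" "\<And>x y. x \<in> S \<Longrightarrow> y \<in> S \<Longrightarrow> x + y \<in> S" "\<And>i. i \<in> A \<Longrightarrow> f i \<in> S"
  shows "sum f A \<in> S"
  using assms by (induction A rule: infinite_finite_induct) auto

lemma carrier_V1_lin_ext:
  "(\<And>i. i \<in> Poly_Mapping.keys v \<Longrightarrow> f i \<in> carrier (V1 \<alpha> \<beta> \<mu>)) \<Longrightarrow> lin_ext f v \<in> carrier (V1 \<alpha> \<beta> \<mu>)"
  unfolding lin_ext_def
  by (rule sum_closed_set) (auto intro: carrier_V1_scale carrier_V1_add carrier_V1_zero)

lemma ebasis_in_V1: "a < l1 \<alpha> \<beta> \<Longrightarrow> b < l2 \<alpha> \<beta> \<Longrightarrow> ebasis a b \<in> carrier (V1 \<alpha> \<beta> \<mu>)"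
  by (simp add: carrier_V1 ebasis_def)

lemma basis_act_in_V1:
  assumes "a < l1 \<alpha> \<beta>" "b < l2 \<alpha> \<beta>"
  shows "basis_act \<alpha> \<beta> \<mu> g (a, b) \<in> carrier (V1 \<alpha> \<beta> \<mu>')"
  using assms by (cases \<mu>; cases g) (auto intro!: carrier_V1_scale ebasis_in_V1)

lemma gen_act_in_V1:
  assumes "v \<in> carrier (V1 \<alpha> \<beta> \<mu>)"
  shows "gen_act \<alpha> \<beta> \<mu> g v \<in> carrier (V1 \<alpha> \<beta> \<mu>)"
  unfolding gen_act_def
proof (rule carrier_V1_lin_ext)
  fix i assume "i \<in> Poly_Mapping.keys v"
  with assms have "fst i < l1 \<alpha> \<beta>" "snd i < l2 \<alpha> \<beta>"
    by (auto simp: carrier_V1)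
  then show "basis_act \<alpha> \<beta> \<mu> g i \<in> carrier (V1 \<alpha> \<beta> \<mu>)"
    using basis_act_in_V1[of "fst i" \<alpha> \<beta> "snd i"] by simp
qed

lemma word_act_in_V1: "v \<in> carrier (V1 \<alpha> \<beta> \<mu>) \<Longrightarrow> word_act \<alpha> \<beta> \<mu> w v \<in> carrier (V1 \<alpha> \<beta> \<mu>)"
proof (cases w)
  case (Word gs)
  assume "v \<in> carrier (V1 \<alpha> \<beta> \<mu>)"
  then show ?thesis
    unfolding Word by (induction gs arbitrary: v) (simp_all add: gen_act_in_V1)
qed

lemma free_act_in_V1: "v \<in> carrier (V1 \<alpha> \<beta> \<mu>) \<Longrightarrow> free_act \<alpha> \<beta> \<mu> v f \<in> carrier (V1 \<alpha> \<beta> \<mu>)"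
  unfolding free_act_def by (rule carrier_V1_lin_ext) (rule word_act_in_V1)

lemma V1_ebasis_expansion:
  "v = (\<Sum>(a, b)\<in>Poly_Mapping.keys v. scale (Poly_Mapping.lookup v (a, b)) (ebasis a b))"
  by (rule poly_mapping_eqI)
    (auto simp: ebasis_def lookup_sum lookup_single when_def in_keys_iff if_distrib
      case_prod_unfold sum.delta cong: if_cong)

abbreviation qmat_ideal :: "'k::field \<Rightarrow> 'k \<Rightarrow> (word \<Rightarrow>\<^sub>0 'k) set"
  where "qmat_ideal \<alpha> \<beta> \<equiv> Idl\<^bsub>free_alg\<^esub> (qmat_relators \<alpha> \<beta>)"

lemma ideal_qmat_ideal: "ideal (qmat_ideal \<alpha> \<beta>) free_alg"
  by (rule ring.genideal_ideal[OF ring_free_alg]) simp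

lemma ring_qmat: "ring (qmat \<alpha> \<beta>)"
  unfolding qmat_def by (rule ideal.quotient_is_ring[OF ideal_qmat_ideal])

lemma free_act_qmat_ideal:
  fixes \<alpha> \<beta> :: "'k::field"
  assumes roots: "root_of_unity \<alpha>" "root_of_unity \<beta>"
    and \<mu>: "\<mu>1 \<noteq> 0" "\<mu>2 \<noteq> 0"
    and v: "v \<in> carrier (V1 \<alpha> \<beta> (\<mu>1, \<mu>2, \<mu>3, \<mu>4))"
    and f: "f \<in> qmat_ideal \<alpha> \<beta>"
  shows "free_act \<alpha> \<beta> (\<mu>1, \<mu>2, \<mu>3, \<mu>4) v f = 0"
proof -
  let ?\<mu> = "(\<mu>1, \<mu>2, \<mu>3, \<mu>4)"
  define J where "J = {f. \<forall>v \<in> carrier (V1 \<alpha> \<beta> ?\<mu>). free_act \<alpha> \<beta> ?\<mu> v f = 0}"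
  interpret F: ring "free_alg :: (word \<Rightarrow>\<^sub>0 'k) ring"
    by (rule ring_free_alg)
  have minus: "\<ominus>\<^bsub>free_alg\<^esub> f = - f" for f :: "word \<Rightarrow>\<^sub>0 'k"
    by (rule F.minus_equality) simp_all
  have "subgroup J (add_monoid free_alg)"
  proof (rule F.add.subgroupI)
    show "J \<noteq> {}"
      by (auto simp: J_def intro!: exI[of _ 0])
    show "\<ominus>\<^bsub>free_alg\<^esub> f \<in> J" if "f \<in> J" for f
      using that free_act_diff_right[of \<alpha> \<beta> ?\<mu> _ 0 f] by (simp add: J_def minus)
  qed (auto simp: J_def free_act_add_right)
  then have "ideal J free_alg"
    by (rule idealI[OF ring_free_alg]) (auto simp: J_def free_act_mult free_act_in_V1)
  moreover have "qmat_relators \<alpha> \<beta> \<subseteq> J"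
  proof
    fix r assume r: "r \<in> qmat_relators \<alpha> \<beta>"
    show "r \<in> J"
      unfolding J_def
    proof (intro CollectI ballI)
      fix v assume v: "v \<in> carrier (V1 \<alpha> \<beta> ?\<mu>)"
      have "free_act \<alpha> \<beta> ?\<mu> (\<Sum>(a, b)\<in>A. scale (c (a, b)) (ebasis a b)) r = 0"
        if "finite A" "A \<subseteq> {0..<l1 \<alpha> \<beta>} \<times> {0..<l2 \<alpha> \<beta>}" for A c
        using that
      proof (induction A rule: finite_induct)
        case (insert x A)
        then show ?case
          using relators_act_ebasis[OF roots \<mu> _ _ r]
          by (cases x) (auto simp: free_act_add_left free_act_scale_left)
      qed simp
      from this[of "Poly_Mapping.keys v" "Poly_Mapping.lookup v"] v
      show "free_act \<alpha> \<beta> ?\<mu> v r = 0"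
        by (simp add: carrier_V1 flip: V1_ebasis_expansion)
    qed
  qed
  ultimately have "qmat_ideal \<alpha> \<beta> \<subseteq> J"
    by (rule F.genideal_minimal)
  then show ?thesis
    using f v by (auto simp: J_def)
qed

abbreviation qmat_class :: "'k::field \<Rightarrow> 'k \<Rightarrow> (word \<Rightarrow>\<^sub>0 'k) \<Rightarrow> (word \<Rightarrow>\<^sub>0 'k) set"
  where "qmat_class \<alpha> \<beta> f \<equiv> qmat_ideal \<alpha> \<beta> +>\<^bsub>free_alg\<^esub> f"

lemma carrier_qmat: "carrier (qmat \<alpha> \<beta>) = range (qmat_class \<alpha> \<beta>)"
  by (auto simp: qmat_def FactRing_def A_RCOSETS_def')

lemma qmat_class_simps:
  "qmat_class \<alpha> \<beta> f \<oplus>\<^bsub>qmat \<alpha> \<beta>\<^esub> qmat_class \<alpha> \<beta> g = qmat_class \<alpha> \<beta> (f + g)"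
  "qmat_class \<alpha> \<beta> f \<otimes>\<^bsub>qmat \<alpha> \<beta>\<^esub> qmat_class \<alpha> \<beta> g = qmat_class \<alpha> \<beta> (f * g)"
  "\<one>\<^bsub>qmat \<alpha> \<beta>\<^esub> = qmat_class \<alpha> \<beta> 1"
proof -
  interpret I: ideal "qmat_ideal \<alpha> \<beta>" free_alg
    by (rule ideal_qmat_ideal)
  show "qmat_class \<alpha> \<beta> f \<oplus>\<^bsub>qmat \<alpha> \<beta>\<^esub> qmat_class \<alpha> \<beta> g = qmat_class \<alpha> \<beta> (f + g)"
    using I.a_rcos_sum[of f g] by (simp add: qmat_def FactRing_def)
  show "qmat_class \<alpha> \<beta> f \<otimes>\<^bsub>qmat \<alpha> \<beta>\<^esub> qmat_class \<alpha> \<beta> g = qmat_class \<alpha> \<beta> (f * g)"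
    using I.rcoset_mult_add[of f g] by (simp add: qmat_def FactRing_def)
  show "\<one>\<^bsub>qmat \<alpha> \<beta>\<^esub> = qmat_class \<alpha> \<beta> 1"
    by (simp add: qmat_def FactRing_def)
qed

lemma V1_ract_coset:
  fixes \<alpha> \<beta> :: "'k::field"
  assumes "root_of_unity \<alpha>" "root_of_unity \<beta>" "\<mu>1 \<noteq> 0" "\<mu>2 \<noteq> 0"
    and v: "v \<in> carrier (V1 \<alpha> \<beta> (\<mu>1, \<mu>2, \<mu>3, \<mu>4))"
  shows "ract (V1 \<alpha> \<beta> (\<mu>1, \<mu>2, \<mu>3, \<mu>4)) v (qmat_class \<alpha> \<beta> f) = free_act \<alpha> \<beta> (\<mu>1, \<mu>2, \<mu>3, \<mu>4) v f"
proof -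
  let ?\<mu> = "(\<mu>1, \<mu>2, \<mu>3, \<mu>4)"
  interpret I: ideal "qmat_ideal \<alpha> \<beta>" free_alg
    by (rule ideal_qmat_ideal)
  have "free_act \<alpha> \<beta> ?\<mu> v g = free_act \<alpha> \<beta> ?\<mu> v f" if "g \<in> qmat_class \<alpha> \<beta> f" for g
    using that free_act_qmat_ideal[OF assms(1-4) v]
    by (auto simp: a_r_coset_def' free_act_add_right)
  moreover have "f \<in> qmat_class \<alpha> \<beta> f"
    by (rule I.a_rcos_self) simp
  ultimately have "free_act \<alpha> \<beta> ?\<mu> v ` qmat_class \<alpha> \<beta> f = {free_act \<alpha> \<beta> ?\<mu> v f}"
    by blast
  then show ?thesis
    by (simp add: V1_def)
qed

lemma abelian_group_V1: "abelian_group (V1 \<alpha> \<beta> \<mu>)"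
proof (rule abelian_groupI)
  fix v assume v: "v \<in> carrier (V1 \<alpha> \<beta> \<mu>)"
  have "- v \<in> carrier (V1 \<alpha> \<beta> \<mu>)"
    using v by (simp add: carrier_V1)
  then show "\<exists>w\<in>carrier (V1 \<alpha> \<beta> \<mu>). w \<oplus>\<^bsub>V1 \<alpha> \<beta> \<mu>\<^esub> v = \<zero>\<^bsub>V1 \<alpha> \<beta> \<mu>\<^esub>"
    by (intro bexI[of _ "- v"]) simp_all
qed (simp_all add: carrier_V1_add carrier_V1_zero algebra_simps)

theorem V1_right_module:
  fixes \<alpha> \<beta> :: "'k::field"
  assumes "root_of_unity \<alpha>" "root_of_unity \<beta>" "\<mu>1 \<noteq> 0" "\<mu>2 \<noteq> 0"
  shows "right_module (qmat \<alpha> \<beta>) (V1 \<alpha> \<beta> (\<mu>1, \<mu>2, \<mu>3, \<mu>4))"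
proof (intro right_module.intro right_module_axioms.intro ring_qmat abelian_group_V1)
qed (auto simp: carrier_qmat qmat_class_simps V1_ract_coset[OF assms] carrier_V1_add free_act_in_V1
    free_act_add_left free_act_add_right free_act_mult)

text \<open>
  The action of the scalars of \<^const>\<open>qmat\<close> is scalar multiplication, so module homomorphisms
  are automatically linear over the ground field.
\<close>

lemma V1_ract_scalar:
  fixes \<alpha> \<beta> :: "'k::field"
  assumes "root_of_unity \<alpha>" "root_of_unity \<beta>" "\<mu>1 \<noteq> 0" "\<mu>2 \<noteq> 0"
    and "v \<in> carrier (V1 \<alpha> \<beta> (\<mu>1, \<mu>2, \<mu>3, \<mu>4))"
  shows "ract (V1 \<alpha> \<beta> (\<mu>1, \<mu>2, \<mu>3, \<mu>4)) v (qmat_class \<alpha> \<beta> (fconst c)) = scale c v"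
  using assms by (simp add: V1_ract_coset)

lemma V1_ract_gen:
  fixes \<alpha> \<beta> :: "'k::field"
  assumes "root_of_unity \<alpha>" "root_of_unity \<beta>" "\<mu>1 \<noteq> 0" "\<mu>2 \<noteq> 0"
    and "a < l1 \<alpha> \<beta>" "b < l2 \<alpha> \<beta>"
  shows "ract (V1 \<alpha> \<beta> (\<mu>1, \<mu>2, \<mu>3, \<mu>4)) (ebasis a b) (qmat_class \<alpha> \<beta> (fvar g))
    = basis_act \<alpha> \<beta> (\<mu>1, \<mu>2, \<mu>3, \<mu>4) g (a, b)"
  using assms by (simp add: V1_ract_coset ebasis_in_V1 gen_act_ebasis)

end

theory Submission
  imports Defs
begin

text \<open>
  The elements \<open>X\<^sub>1\<^sub>2 X\<^sub>2\<^sub>1\<close>, \<open>X\<^sub>1\<^sub>1 X\<^sub>2\<^sub>2 - \<alpha>\<inverse> X\<^sub>1\<^sub>2 X\<^sub>2\<^sub>1\<close>, \<open>X\<^sub>1\<^sub>1\<close> to the power \<open>l\<^sub>1\<close> and \<open>X\<^sub>2\<^sub>1\<close> to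
  the power \<open>l\<^sub>2\<close> act diagonally on the basis \<open>e(a,b)\<close>.  If an isomorphism sends \<open>e(0,0)\<close> to a vector
  with a nonzero coefficient at \<open>e(u,v)\<close>, comparing the eigenvalues at \<open>e(0,0)\<close> and \<open>e(u,v)\<close> gives the
  four equations.  Conversely, extend the basis to a family \<open>E(i,j)\<close> that is quasi-periodic in
  \<open>i\<close> and \<open>j\<close> and on which the generators act without case distinctions; the equations say
  precisely that the shift of \<open>E(i,j)\<close> to a multiple of \<open>E(i+u,j+v)\<close> is compatible with the
  quasi-periodicity and with the action.
\<close>

section \<open>Linear extension of maps given on a basis\<close>

lemma lin_ext_cong:
  "(\<And>i. i \<in> Poly_Mapping.keys v \<Longrightarrow> f i = g i) \<Longrightarrow> lin_ext f v = lin_ext g v"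
  by (simp add: lin_ext_def)

lemma lin_ext_lin_ext: "lin_ext f (lin_ext g v) = lin_ext (\<lambda>i. lin_ext f (g i)) v"
  by (induction v rule: poly_mapping_add_induct) (simp_all add: lin_ext_add lin_ext_scale)

lemma lin_ext_single_id: "lin_ext (\<lambda>i. Poly_Mapping.single i 1) v = v"
  by (induction v rule: poly_mapping_add_induct) (simp_all add: lin_ext_add)

text \<open>A monomial matrix with nonzero weights is inverted by the monomial matrix of the inverse
  permutation with reciprocal weights. This yields bijectivity of the isomorphism built
  below.\<close>

lemma bij_betw_lin_ext_monomial:
  assumes \<sigma>: "bij_betw \<sigma> A A" and c: "\<And>i. i \<in> A \<Longrightarrow> c i \<noteq> 0"
  shows "bij_betw (lin_ext (\<lambda>i. Poly_Mapping.single (\<sigma> i) (c i)))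
    {v. Poly_Mapping.keys v \<subseteq> A} {v. Poly_Mapping.keys v \<subseteq> A}"
proof -
  define \<tau> where "\<tau> = inv_into A \<sigma>"
  have \<tau>: "\<tau> i \<in> A" "\<sigma> (\<tau> i) = i" "\<tau> (\<sigma> i) = i" "\<sigma> i \<in> A" if "i \<in> A" for i
    using \<sigma> that unfolding \<tau>_def bij_betw_def
    by (auto simp: inv_into_into f_inv_into_f)
  have closed: "Poly_Mapping.keys (lin_ext (\<lambda>i. Poly_Mapping.single (\<rho> i) (d i)) v) \<subseteq> A"
    if "\<And>i. i \<in> A \<Longrightarrow> \<rho> i \<in> A" "Poly_Mapping.keys v \<subseteq> A" for v \<rho> and d :: "_ \<Rightarrow> 'b"
  proof -
    have "Poly_Mapping.keys (lin_ext (\<lambda>i. Poly_Mapping.single (\<rho> i) (d i)) v)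
      \<subseteq> (\<Union>i\<in>Poly_Mapping.keys v.
          Poly_Mapping.keys (scale (Poly_Mapping.lookup v i) (Poly_Mapping.single (\<rho> i) (d i))))"
      unfolding lin_ext_def by (rule Poly_Mapping.keys_sum)
    also have "\<dots> \<subseteq> A"
      using that by auto
    finally show ?thesis .
  qed
  show ?thesis
  proof (rule bij_betw_byWitness[where f' = "lin_ext (\<lambda>i. Poly_Mapping.single (\<tau> i) (inverse (c (\<tau> i))))"])
    show "\<forall>v\<in>{v. Poly_Mapping.keys v \<subseteq> A}.
        lin_ext (\<lambda>i. Poly_Mapping.single (\<tau> i) (inverse (c (\<tau> i))))
          (lin_ext (\<lambda>i. Poly_Mapping.single (\<sigma> i) (c i)) v) = v"
      unfolding lin_ext_lin_ext
    proof clarify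
      fix v :: "'a \<Rightarrow>\<^sub>0 'b" assume "Poly_Mapping.keys v \<subseteq> A"
      \<comment> \<open>The \<open>v\<close> on the right is itself the linear extension of the
        basis, so both sides need to be compared only on basis vectors.\<close>
      then show "lin_ext (\<lambda>i. lin_ext (\<lambda>i. Poly_Mapping.single (\<tau> i) (inverse (c (\<tau> i))))
          (Poly_Mapping.single (\<sigma> i) (c i))) v = v"
        by (subst (4) lin_ext_single_id[symmetric], intro lin_ext_cong) (auto simp: \<tau> c)
    qed
    show "\<forall>v\<in>{v. Poly_Mapping.keys v \<subseteq> A}.
        lin_ext (\<lambda>i. Poly_Mapping.single (\<sigma> i) (c i))
          (lin_ext (\<lambda>i. Poly_Mapping.single (\<tau> i) (inverse (c (\<tau> i)))) v) = v"
      unfolding lin_ext_lin_ext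
    proof clarify
      fix v :: "'a \<Rightarrow>\<^sub>0 'b" assume "Poly_Mapping.keys v \<subseteq> A"
      then show "lin_ext (\<lambda>i. lin_ext (\<lambda>i. Poly_Mapping.single (\<sigma> i) (c i))
          (Poly_Mapping.single (\<tau> i) (inverse (c (\<tau> i))))) v = v"
        by (subst (4) lin_ext_single_id[symmetric], intro lin_ext_cong) (auto simp: \<tau> c)
    qed
    show "lin_ext (\<lambda>i. Poly_Mapping.single (\<sigma> i) (c i)) ` {v. Poly_Mapping.keys v \<subseteq> A}
        \<subseteq> {v. Poly_Mapping.keys v \<subseteq> A}"
      using closed[where \<rho> = \<sigma> and d = c] \<tau>(4) by blast
    show "lin_ext (\<lambda>i. Poly_Mapping.single (\<tau> i) (inverse (c (\<tau> i)))) ` {v. Poly_Mapping.keys v \<subseteq> A}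
        \<subseteq> {v. Poly_Mapping.keys v \<subseteq> A}"
      using closed[where \<rho> = \<tau> and d = "\<lambda>i. inverse (c (\<tau> i))"] \<tau>(1) by blast
  qed
qed

lemma bij_betw_add_mod: "bij_betw (\<lambda>a. (a + u) mod n) {0..<n} {0..<n :: nat}"
proof (cases "n = 0")
  case False
  \<comment> \<open>If \<open>a\<close> exceeded \<open>b\<close>, equal residues would force their
    difference to be a positive multiple of \<open>n\<close>, contradicting \<open>a < n\<close>.
    Using this inequality in both directions gives injectivity, which suffices on a finite
    set.\<close>
  have le: "a \<le> b" if mod_eq: "(a + u) mod n = (b + u) mod n" and "a < n" for a b
  proof (rule ccontr)
    assume "\<not> a \<le> b"
    obtain s where "a + u = b + u + n * s"
      by (rule mod_eq_nat1E[OF mod_eq]) (use \<open>\<not> a \<le> b\<close> in simp)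
    then show False
      using \<open>a < n\<close> \<open>\<not> a \<le> b\<close> by (cases s) auto
  qed
  have "inj_on (\<lambda>a. (a + u) mod n) {0..<n}"
    by (rule inj_onI, rule le_antisym) (rule le; simp)+
  moreover have "(\<lambda>a. (a + u) mod n) ` {0..<n} \<subseteq> {0..<n}"
    using False by auto
  ultimately show ?thesis
    by (simp add: bij_betw_def endo_inj_surj)
qed (simp add: bij_betw_def)

section \<open>The quasi-periodic extension of the basis\<close>

text \<open>Each passage of \<open>X21\<close> from \<open>b = l2 - 1\<close> to \<open>0\<close>
  contributes \<open>\<beta>\<close> to the power \<open>- a * l2\<close>; the scalar here collects
  these factors over \<open>j div l2\<close> windings. With this weight the wrap-around cases of the
  action disappear.\<close>

definition ext_basis :: "'k::field \<Rightarrow> 'k \<Rightarrow> nat \<Rightarrow> nat \<Rightarrow> (nat \<times> nat \<Rightarrow>\<^sub>0 'k)"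
  where "ext_basis \<alpha> \<beta> i j = scale (inverse \<beta> ^ (i * l2 \<alpha> \<beta> * (j div l2 \<alpha> \<beta>)))
    (ebasis (i mod l1 \<alpha> \<beta>) (j mod l2 \<alpha> \<beta>))"

lemma ext_basis_eq_ebasis: "a < l1 \<alpha> \<beta> \<Longrightarrow> b < l2 \<alpha> \<beta> \<Longrightarrow> ext_basis \<alpha> \<beta> a b = ebasis a b"
  by (simp add: ext_basis_def)

locale unit_roots =
  fixes \<alpha> \<beta> :: "'k::field"
  assumes \<alpha>: "root_of_unity \<alpha>" and \<beta>: "root_of_unity \<beta>"
begin

abbreviation "E \<equiv> ext_basis \<alpha> \<beta>"
abbreviation "L1 \<equiv> l1 \<alpha> \<beta>"
abbreviation "L2 \<equiv> l2 \<alpha> \<beta>"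

lemma nz: "\<alpha> \<noteq> 0" "\<beta> \<noteq> 0"
  using \<alpha> \<beta> root_of_unity_nonzero by auto

lemma L_pos: "L1 > 0" "L2 > 0"
  using l1_pos[OF \<alpha> \<beta>] l2_pos[OF \<alpha> \<beta>] .

text \<open>This rests on \<open>power_l1_l2\<close>: \<open>\<beta> ^ (L1 * L2) = 1\<close>, in
  both cases of the definition of \<open>l1\<close>. It makes the weight of \<open>E i j\<close>
  depend on \<open>i\<close> only modulo \<open>L1\<close>.\<close>

lemma inverse_\<beta>_power_mod: "inverse \<beta> ^ (i mod L1 * L2 * k) = inverse \<beta> ^ (i * L2 * k)"
proof -
  have "(inverse \<beta> ^ (L2 * k)) ^ L1 = inverse (\<beta> ^ (L1 * L2)) ^ k"
    by (simp add: power_inverse mult_ac flip: power_mult)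
  then have "(inverse \<beta> ^ (L2 * k)) ^ L1 = 1"
    by (simp add: power_l1_l2 nz)
  from power_mod_cycle[OF this L_pos(1), of i] show ?thesis
    by (simp add: mult_ac flip: power_mult)
qed

lemma inverse_\<alpha>\<beta>_power_mod: "inverse (\<alpha> * \<beta>) ^ (i mod L1) = inverse (\<alpha> * \<beta>) ^ i"
  by (rule power_mod_cycle[OF _ L_pos(1)]) (simp only: power_inverse power_l1 nz inverse_1 not_False_eq_True)

lemma quot_power_mod: "(inverse \<alpha> * \<beta>) ^ (j mod L2) = (inverse \<alpha> * \<beta>) ^ j"
  by (rule power_mod_cycle[OF _ L_pos(2)]) (simp add: power_mult_distrib power_inverse power_l2[OF nz] nz)

lemma E_add_L1: "E (i + L1) j = E i j"
  using inverse_\<beta>_power_mod[of "i + L1" "j div L2"] inverse_\<beta>_power_mod[of i "j div L2"]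
  by (simp add: ext_basis_def)

lemma E_add_L2: "E i (j + L2) = scale (inverse \<beta> ^ (i * L2)) (E i j)"
  using L_pos by (simp add: ext_basis_def power_add distrib_left mult_ac)

lemma ebasis_eq_E:
  assumes "a < L1" "b < L2"
  shows "ebasis a b = scale (\<beta> ^ (a * L2)) (E (a + L1) (b + L2))"
  using assms nz by (simp add: E_add_L1[of a "b + L2"] E_add_L2[of a b] ext_basis_eq_ebasis power_inverse)

lemma gen_act_G11: "gen_act \<alpha> \<beta> (\<mu>1, \<mu>2, \<mu>3, \<mu>4) G11 (E i j) = scale (\<mu>1 * \<beta> ^ j) (E (Suc i) j)"
proof -
  define k where "k = j div L2"
  have "\<beta> ^ j = \<beta> ^ (L2 * k) * \<beta> ^ (j mod L2)"
    by (simp add: k_def flip: power_add)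
  \<comment> \<open>The part of \<open>\<beta> ^ j\<close> belonging to the \<open>k\<close> full
    windings is exactly what the weight of \<open>E\<close> loses when \<open>i\<close> grows by
    one.\<close>
  then have "\<mu>1 * \<beta> ^ j * inverse \<beta> ^ (Suc i * L2 * k) = inverse \<beta> ^ (i * L2 * k) * (\<mu>1 * \<beta> ^ (j mod L2))"
    using nz by (simp add: distrib_right power_add power_inverse)
  then show ?thesis
    by (simp only: ext_basis_def gen_act_scale gen_act_ebasis basis_act.simps scale_simps mod_Suc_eq
        Suc_eq_plus1[symmetric] k_def[symmetric])
qed

text \<open>At the wrap-around the extra factor in the action is absorbed by the increase of
  \<open>j div L2\<close>; otherwise the weight does not change.\<close>

lemma gen_act_G21: "gen_act \<alpha> \<beta> (\<mu>1, \<mu>2, \<mu>3, \<mu>4) G21 (E i j) = scale \<mu>2 (E i (Suc j))"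
proof (cases "j mod L2 = L2 - 1")
  case True
  then have "Suc (j mod L2) = L2"
    using L_pos by simp
  then have "Suc j mod L2 = 0" "Suc j div L2 = Suc (j div L2)"
    by (simp_all add: mod_Suc div_Suc)
  then show ?thesis
    using True inverse_\<beta>_power_mod[of i 1]
    by (simp add: ext_basis_def gen_act_scale gen_act_ebasis power_add mult_ac)
next
  case False
  then have "Suc (j mod L2) \<noteq> L2"
    by auto
  then have "Suc j mod L2 = Suc (j mod L2)" "Suc j div L2 = j div L2"
    by (simp_all add: mod_Suc div_Suc)
  then show ?thesis
    using False by (simp add: ext_basis_def gen_act_scale gen_act_ebasis mult_ac)
qed

lemma gen_act_G12:
  "gen_act \<alpha> \<beta> (\<mu>1, \<mu>2, \<mu>3, \<mu>4) G12 (E i (Suc j)) =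
    scale (inverse \<mu>2 * \<mu>3 * (inverse \<alpha> * \<beta>) ^ Suc j * inverse (\<alpha> * \<beta>) ^ i) (E i j)"
proof (cases "Suc (j mod L2) = L2")
  case True
  then have *: "Suc j mod L2 = 0" "Suc j div L2 = Suc (j div L2)" "j mod L2 = L2 - 1"
    by (simp_all add: mod_Suc div_Suc)
  have "inverse \<beta> ^ (i mod L1 * L2) = inverse \<beta> ^ (i * L2)"
    using inverse_\<beta>_power_mod[of i 1] by simp
  then have **: "\<beta> ^ (i mod L1 * L2) = \<beta> ^ (i * L2)"
    by (simp add: power_inverse)
  \<comment> \<open>The action on \<open>e(a,0)\<close> carries no power of
    \<open>inverse \<alpha> * \<beta>\<close>; the uniform formula agrees because \<open>L2\<close>
    divides \<open>Suc j\<close>. The remaining factor \<open>\<beta> ^ (i * L2)\<close> removes one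
    winding from the weight.\<close>
  have q: "(inverse \<alpha> * \<beta>) ^ Suc j = 1"
    using quot_power_mod[of "Suc j"] * by simp
  have key: "inverse \<beta> ^ (i * L2 * Suc (j div L2)) * \<beta> ^ (i * L2) = inverse \<beta> ^ (i * L2 * (j div L2))"
    using nz by (simp add: power_add power_inverse)
  have "inverse \<beta> ^ (i * L2 * Suc (j div L2)) * (inverse \<mu>2 * \<mu>3 * \<beta> ^ (i * L2) * inverse (\<alpha> * \<beta>) ^ i)
    = inverse \<mu>2 * \<mu>3 * inverse (\<alpha> * \<beta>) ^ i * inverse \<beta> ^ (i * L2 * (j div L2))"
    unfolding key[symmetric] by (simp only: mult_ac)
  then show ?thesis
    unfolding q by (simp only: ext_basis_def gen_act_scale gen_act_ebasis basis_act.simps scale_simps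
        * ** inverse_\<alpha>\<beta>_power_mod simp_thms if_False mult_1_right)
next
  case False
  then have "Suc j mod L2 = Suc (j mod L2)" "Suc j div L2 = j div L2"
    by (simp_all add: mod_Suc div_Suc)
  then show ?thesis
    using quot_power_mod[of "Suc j"]
    by (simp add: ext_basis_def gen_act_scale gen_act_ebasis inverse_\<alpha>\<beta>_power_mod mult_ac
        del: inverse_mult_distrib power_Suc)
qed

lemma gen_act_G22:
  "gen_act \<alpha> \<beta> (\<mu>1, \<mu>2, \<mu>3, \<mu>4) G22 (E (Suc i) j) =
    scale (inverse \<mu>1 * inverse \<alpha> ^ j * (\<mu>4 + \<beta> * inverse (\<alpha> * \<beta>) ^ Suc i * \<mu>3)) (E i j)"
proof -
  have *: "(Suc i mod L1 + (L1 - 1)) mod L1 = i mod L1"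
    using mod_cycle(1)[of "i mod L1" L1] L_pos by (simp add: mod_Suc_eq)
  define k where "k = j div L2"
  have "inverse \<alpha> ^ j = inverse \<alpha> ^ (L2 * k) * inverse \<alpha> ^ (j mod L2)"
    by (simp add: k_def flip: power_add)
  \<comment> \<open>Since \<open>\<alpha>\<close> and \<open>\<beta>\<close> have the same
    \<open>L2\<close>-th power, the full windings in the \<open>\<alpha>\<close>-power turn into the
    change of weight caused by lowering \<open>i\<close>.\<close>
  also have "inverse \<alpha> ^ (L2 * k) = inverse \<beta> ^ (L2 * k)"
    by (simp add: power_mult power_inverse power_l2[OF nz])
  finally have key: "inverse \<alpha> ^ j * inverse \<beta> ^ (i * L2 * k) = inverse \<beta> ^ (Suc i * L2 * k) * inverse \<alpha> ^ (j mod L2)"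
    by (simp add: distrib_right distrib_left power_add mult_ac)
  have "inverse \<beta> ^ (Suc i * L2 * k) * (inverse \<mu>1 * inverse \<alpha> ^ (j mod L2) * x)
    = inverse \<mu>1 * inverse \<alpha> ^ j * x * inverse \<beta> ^ (i * L2 * k)" for x
  proof -
    have "inverse \<beta> ^ (Suc i * L2 * k) * (inverse \<mu>1 * inverse \<alpha> ^ (j mod L2) * x)
      = inverse \<mu>1 * (inverse \<beta> ^ (Suc i * L2 * k) * inverse \<alpha> ^ (j mod L2)) * x"
      by (simp only: mult_ac)
    then show ?thesis
      unfolding key[symmetric] by (simp only: mult_ac)
  qed
  then show ?thesis
    by (simp only: ext_basis_def gen_act_scale gen_act_ebasis basis_act.simps scale_simps *
        inverse_\<alpha>\<beta>_power_mod k_def[symmetric])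
qed

section \<open>Four operators that are diagonal on the basis\<close>

lemma free_act_G11_power:
  "free_act \<alpha> \<beta> (\<mu>1, \<mu>2, \<mu>3, \<mu>4) (E i j) (fvar G11 ^ n) = scale (\<mu>1 ^ n * \<beta> ^ (j * n)) (E (i + n) j)"
  by (induction n) (simp_all add: power_Suc2 free_act_mult gen_act_scale gen_act_G11 power_add mult_ac
      del: power_Suc)

lemma free_act_G21_power:
  "free_act \<alpha> \<beta> (\<mu>1, \<mu>2, \<mu>3, \<mu>4) (E i j) (fvar G21 ^ n) = scale (\<mu>2 ^ n) (E i (j + n))"
  by (induction n) (simp_all add: power_Suc2 free_act_mult gen_act_scale gen_act_G21 mult_ac
      del: power_Suc)

lemma free_act_G11_power_L1:
  assumes "a < L1" "b < L2"
  shows "free_act \<alpha> \<beta> (\<mu>1, \<mu>2, \<mu>3, \<mu>4) (ebasis a b) (fvar G11 ^ L1)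
    = scale (\<mu>1 ^ L1 * \<beta> ^ (b * L1)) (ebasis a b)"
  using free_act_G11_power[of \<mu>1 \<mu>2 \<mu>3 \<mu>4 a b L1] assms by (simp add: E_add_L1 ext_basis_eq_ebasis)

lemma free_act_G21_power_L2:
  assumes "a < L1" "b < L2"
  shows "free_act \<alpha> \<beta> (\<mu>1, \<mu>2, \<mu>3, \<mu>4) (ebasis a b) (fvar G21 ^ L2)
    = scale (\<mu>2 ^ L2 * inverse \<beta> ^ (a * L2)) (ebasis a b)"
  using free_act_G21_power[of \<mu>1 \<mu>2 \<mu>3 \<mu>4 a b L2] assms by (simp add: E_add_L2 ext_basis_eq_ebasis)

text \<open>\<open>X12\<close> and \<open>X22\<close> lower an index, so their uniform formulas
  require successors. Quasi-periodicity moves any basis vector to such indices, including those with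
  \<open>a = 0\<close> or \<open>b = 0\<close>.\<close>

lemma ebasis_eq_E_Suc:
  assumes "a < L1" "b < L2"
  obtains c i j where "ebasis a b = scale c (E (Suc i) (Suc j))" "Suc i mod L1 = a" "Suc j mod L2 = b"
proof -
  \<comment> \<open>The indices are raised by one period less one, so that their successors are full
    shifts; positivity of the periods keeps the truncated subtraction exact.\<close>
  have *: "Suc (a + L1 - 1) = a + L1" "Suc (b + L2 - 1) = b + L2"
    using L_pos by simp_all
  show thesis
    by (rule that[of _ "a + L1 - 1" "b + L2 - 1"], unfold *)
      (use ebasis_eq_E[OF assms] assms in simp_all)
qed

text \<open>\<open>X12\<close> lowers the second index and \<open>X21\<close> restores it, while the
  factors \<open>inverse \<mu>2\<close> and \<open>\<mu>2\<close> cancel.\<close>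

lemma free_act_G12_G21:
  assumes "a < L1" "b < L2" "\<mu>2 \<noteq> 0"
  shows "free_act \<alpha> \<beta> (\<mu>1, \<mu>2, \<mu>3, \<mu>4) (ebasis a b) (fvar G12 * fvar G21)
    = scale (\<mu>3 * (inverse \<alpha> * \<beta>) ^ b * inverse (\<alpha> * \<beta>) ^ a) (ebasis a b)"
proof -
  obtain c i j where e: "ebasis a b = scale c (E (Suc i) (Suc j))"
    and ij: "Suc i mod L1 = a" "Suc j mod L2 = b"
    using assms by (rule_tac ebasis_eq_E_Suc)
  have p: "inverse (\<alpha> * \<beta>) ^ Suc i = inverse (\<alpha> * \<beta>) ^ a" "(inverse \<alpha> * \<beta>) ^ Suc j = (inverse \<alpha> * \<beta>) ^ b"
    using inverse_\<alpha>\<beta>_power_mod[of "Suc i"] quot_power_mod[of "Suc j"] ij by simp_all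
  show ?thesis
    using assms(3) unfolding e free_act_mult free_act_fvar gen_act_scale gen_act_G12 gen_act_G21 p
    by (simp add: field_simps)
qed

text \<open>The acting element is the quantum determinant. Subtracting the multiple of
  \<open>X12 X21\<close> removes \<open>\<mu>3\<close> from the eigenvalue and isolates
  \<open>\<mu>4\<close>.\<close>

lemma free_act_qdet:
  assumes "a < L1" "b < L2" "\<mu>1 \<noteq> 0" "\<mu>2 \<noteq> 0"
  shows "free_act \<alpha> \<beta> (\<mu>1, \<mu>2, \<mu>3, \<mu>4) (ebasis a b)
      (fvar G11 * fvar G22 - fconst (inverse \<alpha>) * (fvar G12 * fvar G21))
    = scale (\<mu>4 * (inverse \<alpha> * \<beta>) ^ b) (ebasis a b)"
proof -
  have "free_act \<alpha> \<beta> (\<mu>1, \<mu>2, \<mu>3, \<mu>4) (ebasis a b) (fvar G11 * fvar G22)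
    = scale (\<beta> ^ b * inverse \<alpha> ^ b * (\<mu>4 + \<beta> * inverse (\<alpha> * \<beta>) ^ Suc a * \<mu>3)) (ebasis a b)"
  proof -
    have "\<mu>1 * \<beta> ^ b * (inverse \<mu>1 * inverse \<alpha> ^ b * x) = \<beta> ^ b * inverse \<alpha> ^ b * x" for x
      using assms(3) by simp
    then show ?thesis
      using assms(1,2) gen_act_G11[of \<mu>1 \<mu>2 \<mu>3 \<mu>4 a b] gen_act_G22[of \<mu>1 \<mu>2 \<mu>3 \<mu>4 a b]
      by (simp only: free_act_mult free_act_fvar gen_act_scale ext_basis_eq_ebasis scale_simps)
  qed
  \<comment> \<open>The \<open>\<mu>3\<close> terms cancel because
    \<open>\<beta> * inverse (\<alpha> * \<beta>) ^ Suc a\<close> equals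
    \<open>inverse \<alpha> * inverse (\<alpha> * \<beta>) ^ a\<close>.\<close>
  moreover have "\<beta> ^ b * inverse \<alpha> ^ b * (\<mu>4 + \<beta> * inverse (\<alpha> * \<beta>) ^ Suc a * \<mu>3)
      - inverse \<alpha> * (\<mu>3 * (inverse \<alpha> * \<beta>) ^ b * inverse (\<alpha> * \<beta>) ^ a) = \<mu>4 * (inverse \<alpha> * \<beta>) ^ b"
    using nz by (simp add: power_mult_distrib field_simps)
  ultimately show ?thesis
    by (simp only: free_act_diff_right free_act_mult[of _ _ _ _ "fconst _"] free_act_fconst
        free_act_scale_left free_act_G12_G21[OF assms(1,2,4)] scale_simps flip: scale_diff_left)
qed

end

section \<open>Eigenvalues under homomorphisms and the necessary conditions\<close>

lemma free_act_eq_lin_ext: "free_act \<alpha> \<beta> \<mu> w f = lin_ext (\<lambda>i. free_act \<alpha> \<beta> \<mu> (Poly_Mapping.single i 1) f) w"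
proof (induction w rule: poly_mapping_add_induct)
  case (single i c)
  show ?case
    using free_act_scale_left[of \<alpha> \<beta> \<mu> c "Poly_Mapping.single i 1" f] by simp
qed (simp_all add: free_act_add_left lin_ext_add)

lemma lookup_lin_ext_diagonal:
  "Poly_Mapping.lookup (lin_ext (\<lambda>i. Poly_Mapping.single i (d i)) w) k = d k * Poly_Mapping.lookup w k"
  by (induction w rule: poly_mapping_add_induct)
    (auto simp: lin_ext_add lookup_add distrib_left lookup_single when_def)

lemma lookup_free_act_diagonal:
  assumes "\<And>a b. a < l1 \<alpha> \<beta> \<Longrightarrow> b < l2 \<alpha> \<beta> \<Longrightarrow>
      free_act \<alpha> \<beta> \<mu> (ebasis a b) f = scale (d a b) (ebasis a b)"
    and "w \<in> carrier (V1 \<alpha> \<beta> \<mu>)"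
  shows "Poly_Mapping.lookup (free_act \<alpha> \<beta> \<mu> w f) (u, v) = d u v * Poly_Mapping.lookup w (u, v)"
proof -
  have "free_act \<alpha> \<beta> \<mu> w f = lin_ext (\<lambda>i. Poly_Mapping.single i (d (fst i) (snd i))) w"
    unfolding free_act_eq_lin_ext[of _ _ _ w]
  proof (rule lin_ext_cong)
    fix i assume "i \<in> Poly_Mapping.keys w"
    with assms(2) show "free_act \<alpha> \<beta> \<mu> (Poly_Mapping.single i 1) f = Poly_Mapping.single i (d (fst i) (snd i))"
      using assms(1)[of "fst i" "snd i"] by (auto simp: carrier_V1 ebasis_def)
  qed
  then show ?thesis
    by (simp add: lookup_lin_ext_diagonal)
qed

lemma rmodule_hom_V1_free_act:
  fixes \<alpha> \<beta> :: "'k::field"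
  assumes roots: "root_of_unity \<alpha>" "root_of_unity \<beta>"
    and nz: "\<mu>1 \<noteq> 0" "\<mu>2 \<noteq> 0" "\<nu>1 \<noteq> 0" "\<nu>2 \<noteq> 0"
    and h: "h \<in> rmodule_hom (qmat \<alpha> \<beta>) (V1 \<alpha> \<beta> (\<mu>1, \<mu>2, \<mu>3, \<mu>4)) (V1 \<alpha> \<beta> (\<nu>1, \<nu>2, \<nu>3, \<nu>4))"
    and w: "w \<in> carrier (V1 \<alpha> \<beta> (\<mu>1, \<mu>2, \<mu>3, \<mu>4))"
  shows "h (free_act \<alpha> \<beta> (\<mu>1, \<mu>2, \<mu>3, \<mu>4) w f) = free_act \<alpha> \<beta> (\<nu>1, \<nu>2, \<nu>3, \<nu>4) (h w) f"
proof -
  have "h w \<in> carrier (V1 \<alpha> \<beta> (\<nu>1, \<nu>2, \<nu>3, \<nu>4))"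
    using h w by (auto simp: rmodule_hom_def)
  moreover have "h (ract (V1 \<alpha> \<beta> (\<mu>1, \<mu>2, \<mu>3, \<mu>4)) w (qmat_class \<alpha> \<beta> f))
      = ract (V1 \<alpha> \<beta> (\<nu>1, \<nu>2, \<nu>3, \<nu>4)) (h w) (qmat_class \<alpha> \<beta> f)"
    using h w by (auto simp: rmodule_hom_def carrier_qmat)
  ultimately show ?thesis
    using V1_ract_coset[OF roots nz(1,2) w] V1_ract_coset[OF roots nz(3,4)] by simp
qed

text \<open>A homomorphism maps an eigenvector of \<open>f\<close> to a vector on which
  \<open>f\<close> acts by the same scalar. If \<open>f\<close> is diagonal on the target, each
  nonzero coordinate there determines that scalar.\<close>

lemma rmodule_hom_V1_eigenvalue:
  fixes \<alpha> \<beta> :: "'k::field"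
  assumes roots: "root_of_unity \<alpha>" "root_of_unity \<beta>"
    and nz: "\<mu>1 \<noteq> 0" "\<mu>2 \<noteq> 0" "\<nu>1 \<noteq> 0" "\<nu>2 \<noteq> 0"
    and h: "h \<in> rmodule_hom (qmat \<alpha> \<beta>) (V1 \<alpha> \<beta> (\<mu>1, \<mu>2, \<mu>3, \<mu>4)) (V1 \<alpha> \<beta> (\<nu>1, \<nu>2, \<nu>3, \<nu>4))"
    and w: "w \<in> carrier (V1 \<alpha> \<beta> (\<mu>1, \<mu>2, \<mu>3, \<mu>4))" "Poly_Mapping.lookup (h w) (u, v) \<noteq> 0"
    and c: "free_act \<alpha> \<beta> (\<mu>1, \<mu>2, \<mu>3, \<mu>4) w f = scale c w"
    and d: "\<And>a b. a < l1 \<alpha> \<beta> \<Longrightarrow> b < l2 \<alpha> \<beta> \<Longrightarrow>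
      free_act \<alpha> \<beta> (\<nu>1, \<nu>2, \<nu>3, \<nu>4) (ebasis a b) f = scale (d a b) (ebasis a b)"
  shows "c = d u v"
proof -
  note act = rmodule_hom_V1_free_act[OF roots nz h w(1)]
  have "h w \<in> carrier (V1 \<alpha> \<beta> (\<nu>1, \<nu>2, \<nu>3, \<nu>4))"
    using h w by (auto simp: rmodule_hom_def)
  \<comment> \<open>\<open>rmodule_hom\<close> demands only additivity; linearity over the field
    comes from the action of the constants.\<close>
  have "scale c (h w) = h (scale c w)"
    using act[of "fconst c"] by simp
  also have "\<dots> = free_act \<alpha> \<beta> (\<nu>1, \<nu>2, \<nu>3, \<nu>4) (h w) f"
    using act[of f] c by simp
  finally have "c * Poly_Mapping.lookup (h w) (u, v) = d u v * Poly_Mapping.lookup (h w) (u, v)"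
    using lookup_free_act_diagonal[OF d \<open>h w \<in> _\<close>] by (metis lookup_scale)
  then show ?thesis
    using w(2) by simp
qed

text \<open>The numerical conditions for natural \<open>u\<close> and \<open>v\<close>, with
  negative powers written as powers of inverses; the bounds on \<open>u\<close> and \<open>v\<close>
  are kept apart.\<close>

definition linked_params :: "'k::field \<Rightarrow> 'k \<Rightarrow> 'k param \<Rightarrow> 'k param \<Rightarrow> nat \<Rightarrow> nat \<Rightarrow> bool"
  where "linked_params \<alpha> \<beta> = (\<lambda>(\<mu>1, \<mu>2, \<mu>3, \<mu>4) (\<nu>1, \<nu>2, \<nu>3, \<nu>4) u v.
    \<mu>1 ^ l1 \<alpha> \<beta> = \<nu>1 ^ l1 \<alpha> \<beta> * \<beta> ^ (v * l1 \<alpha> \<beta>) \<and>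
    \<mu>2 ^ l2 \<alpha> \<beta> = \<nu>2 ^ l2 \<alpha> \<beta> * inverse \<beta> ^ (u * l2 \<alpha> \<beta>) \<and>
    \<mu>3 = \<nu>3 * (inverse \<alpha> * \<beta>) ^ v * inverse (\<alpha> * \<beta>) ^ u \<and>
    \<mu>4 = \<nu>4 * (inverse \<alpha> * \<beta>) ^ v)"

context unit_roots
begin

lemma isomorphic_imp_linked:
  assumes nz: "\<mu>1 \<noteq> 0" "\<mu>2 \<noteq> 0" "\<nu>1 \<noteq> 0" "\<nu>2 \<noteq> 0"
    and "rmodule_isomorphic (qmat \<alpha> \<beta>) (V1 \<alpha> \<beta> (\<mu>1, \<mu>2, \<mu>3, \<mu>4)) (V1 \<alpha> \<beta> (\<nu>1, \<nu>2, \<nu>3, \<nu>4))"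
  shows "\<exists>u v. u < L1 \<and> v < L2 \<and> linked_params \<alpha> \<beta> (\<mu>1, \<mu>2, \<mu>3, \<mu>4) (\<nu>1, \<nu>2, \<nu>3, \<nu>4) u v"
proof -
  let ?M = "V1 \<alpha> \<beta> (\<mu>1, \<mu>2, \<mu>3, \<mu>4)" and ?N = "V1 \<alpha> \<beta> (\<nu>1, \<nu>2, \<nu>3, \<nu>4)"
  obtain h where h: "h \<in> rmodule_hom (qmat \<alpha> \<beta>) ?M ?N" and bij: "bij_betw h (carrier ?M) (carrier ?N)"
    using assms by (auto simp: rmodule_isomorphic_def)
  have e: "ebasis 0 0 \<in> carrier ?M"
    by (rule ebasis_in_V1) (fact L_pos)+
  have "h 0 = 0"
    using rmodule_hom_V1_free_act[OF \<alpha> \<beta> nz h carrier_V1_zero, of 0] by simp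
  moreover have "ebasis 0 0 \<noteq> (0 :: nat \<times> nat \<Rightarrow>\<^sub>0 'k)"
    unfolding ebasis_def by (metis lookup_single_eq lookup_zero zero_neq_one)
  ultimately have "h (ebasis 0 0) \<noteq> 0"
    using bij e carrier_V1_zero unfolding bij_betw_def by (metis inj_onD)
  \<comment> \<open>Any nonzero coordinate of the image of \<open>e(0,0)\<close> may serve as the
    pair of shifts.\<close>
  then obtain u v where uv: "Poly_Mapping.lookup (h (ebasis 0 0)) (u, v) \<noteq> 0"
    by (metis poly_mapping_eqI lookup_zero surj_pair)
  moreover have "h (ebasis 0 0) \<in> carrier ?N"
    using bij e by (rule bij_betwE[THEN bspec])
  ultimately have "u < L1" "v < L2"
    by (auto simp: carrier_V1 in_keys_iff)
  \<comment> \<open>At \<open>e(0,0)\<close> the four diagonal operators have eigenvalues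
    \<open>\<mu>1 ^ L1\<close>, \<open>\<mu>2 ^ L2\<close>, \<open>\<mu>3\<close> and
    \<open>\<mu>4\<close>. Each use of \<open>eig\<close> takes one of them as \<open>f\<close>,
    with \<open>d\<close> its eigenvalue on the target.\<close>
  note eig = rmodule_hom_V1_eigenvalue[OF \<alpha> \<beta> nz h e uv]
  have "\<mu>1 ^ L1 = \<nu>1 ^ L1 * \<beta> ^ (v * L1)"
    by (rule eig[where f = "fvar G11 ^ L1" and d = "\<lambda>a b. \<nu>1 ^ L1 * \<beta> ^ (b * L1)"])
      (simp_all add: free_act_G11_power_L1 L_pos)
  moreover have "\<mu>2 ^ L2 = \<nu>2 ^ L2 * inverse \<beta> ^ (u * L2)"
    by (rule eig[where f = "fvar G21 ^ L2" and d = "\<lambda>a b. \<nu>2 ^ L2 * inverse \<beta> ^ (a * L2)"])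
      (simp_all add: free_act_G21_power_L2 L_pos)
  moreover have "\<mu>3 = \<nu>3 * (inverse \<alpha> * \<beta>) ^ v * inverse (\<alpha> * \<beta>) ^ u"
    by (rule eig[where f = "fvar G12 * fvar G21"
          and d = "\<lambda>a b. \<nu>3 * (inverse \<alpha> * \<beta>) ^ b * inverse (\<alpha> * \<beta>) ^ a"])
      (simp_all add: free_act_G12_G21 L_pos nz)
  moreover have "\<mu>4 = \<nu>4 * (inverse \<alpha> * \<beta>) ^ v"
    by (rule eig[where f = "fvar G11 * fvar G22 - fconst (inverse \<alpha>) * (fvar G12 * fvar G21)"
          and d = "\<lambda>a b. \<nu>4 * (inverse \<alpha> * \<beta>) ^ b"])
      (simp_all add: free_act_qdet L_pos nz)
  ultimately show ?thesis
    using \<open>u < L1\<close> \<open>v < L2\<close> by (auto simp: linked_params_def)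
qed

end

section \<open>The isomorphism built from linked parameters\<close>

text \<open>Compatibility with the generators passes to words by induction, the carrier being stable
  under each letter, and then to their combinations by linearity.\<close>

lemma free_act_intertwine:
  assumes h: "\<And>w g. w \<in> carrier (V1 \<alpha> \<beta> \<mu>) \<Longrightarrow>
      lin_ext F (gen_act \<alpha> \<beta> \<mu> g w) = gen_act \<alpha> \<beta> \<nu> g (lin_ext F w)"
    and w: "w \<in> carrier (V1 \<alpha> \<beta> \<mu>)"
  shows "lin_ext F (free_act \<alpha> \<beta> \<mu> w f) = free_act \<alpha> \<beta> \<nu> (lin_ext F w) f"
proof -
  have "lin_ext F (word_act \<alpha> \<beta> \<mu> (Word gs) w) = word_act \<alpha> \<beta> \<nu> (Word gs) (lin_ext F w)" for gs
    using w by (induction gs arbitrary: w) (simp_all add: h gen_act_in_V1)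
  then have "lin_ext F (word_act \<alpha> \<beta> \<mu> x w) = word_act \<alpha> \<beta> \<nu> x (lin_ext F w)" for x
    by (cases x) simp
  then show ?thesis
    unfolding free_act_def lin_ext_lin_ext by simp
qed
context unit_roots
begin

lemma linked_imp_isomorphic:
  assumes nz': "\<mu>1 \<noteq> 0" "\<mu>2 \<noteq> 0" "\<nu>1 \<noteq> 0" "\<nu>2 \<noteq> 0"
    and linked: "linked_params \<alpha> \<beta> (\<mu>1, \<mu>2, \<mu>3, \<mu>4) (\<nu>1, \<nu>2, \<nu>3, \<nu>4) u v"
  shows "rmodule_isomorphic (qmat \<alpha> \<beta>) (V1 \<alpha> \<beta> (\<mu>1, \<mu>2, \<mu>3, \<mu>4)) (V1 \<alpha> \<beta> (\<nu>1, \<nu>2, \<nu>3, \<nu>4))"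
proof -
  let ?\<mu> = "(\<mu>1, \<mu>2, \<mu>3, \<mu>4)" and ?\<nu> = "(\<nu>1, \<nu>2, \<nu>3, \<nu>4)"
  let ?q = "inverse \<alpha> * \<beta>" and ?p = "inverse (\<alpha> * \<beta>)"
  have \<mu>1: "\<mu>1 ^ L1 = \<nu>1 ^ L1 * \<beta> ^ (v * L1)"
    and \<mu>2: "\<mu>2 ^ L2 = \<nu>2 ^ L2 * inverse \<beta> ^ (u * L2)"
    and \<mu>3: "\<mu>3 = \<nu>3 * ?q ^ v * ?p ^ u"
    and \<mu>4: "\<mu>4 = \<nu>4 * ?q ^ v"
    using linked by (simp_all add: linked_params_def)
  \<comment> \<open>Compatibility with \<open>X11\<close> forces
    \<open>\<mu>1 * s = \<nu>1 * \<beta> ^ v\<close>, and compatibility with \<open>X21\<close>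
    forces \<open>\<mu>2 * t = \<nu>2\<close>. The first two linking equations then become the
    identities \<open>s\<close> and \<open>t\<close> below.\<close>
  define s where "s = \<nu>1 * inverse \<mu>1 * \<beta> ^ v"
  define t where "t = \<nu>2 * inverse \<mu>2"
  have "s ^ L1 = inverse (\<mu>1 ^ L1) * (\<nu>1 ^ L1 * \<beta> ^ (v * L1))"
    by (simp add: s_def power_mult_distrib power_inverse power_mult mult_ac)
  then have s: "s ^ L1 = 1"
    using nz' by (simp flip: \<mu>1)
  have "t ^ L2 * inverse \<beta> ^ (u * L2) = inverse (\<mu>2 ^ L2) * (\<nu>2 ^ L2 * inverse \<beta> ^ (u * L2))"
    by (simp add: t_def power_mult_distrib power_inverse mult_ac)
  then have t: "t ^ L2 * inverse \<beta> ^ (u * L2) = 1"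
    using nz' by (simp flip: \<mu>2)
  define G where "G i j = scale (s ^ i * t ^ j) (E (i + u) (j + v))" for i j
  define F where "F = (\<lambda>(a, b). G a b)"
  \<comment> \<open>These two facts show that the weighted shift \<open>G\<close> has the same
    quasi-periods as \<open>E\<close>, so that prescribing \<open>F\<close> on the basis is
    consistent with all indices.\<close>
  have G_add_L1: "G (i + L1) j = G i j" for i j
    using E_add_L1[of "i + u" "j + v"] s by (simp add: G_def power_add add_ac)
  have G_add_L2: "G i (j + L2) = scale (inverse \<beta> ^ (i * L2)) (G i j)" for i j
  proof -
    have "s ^ i * t ^ (j + L2) * inverse \<beta> ^ ((i + u) * L2)
        = inverse \<beta> ^ (i * L2) * (s ^ i * t ^ j) * (t ^ L2 * inverse \<beta> ^ (u * L2))"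
      by (simp add: power_add distrib_right distrib_left mult_ac)
    then have *: "s ^ i * t ^ (j + L2) * inverse \<beta> ^ ((i + u) * L2) = inverse \<beta> ^ (i * L2) * (s ^ i * t ^ j)"
      by (simp only: t mult_1_right)
    have "E (i + u) (j + L2 + v) = scale (inverse \<beta> ^ ((i + u) * L2)) (E (i + u) (j + v))"
      using E_add_L2[of "i + u" "j + v"] by (simp add: add_ac)
    then show ?thesis
      unfolding G_def by (simp only: scale_simps *)
  qed
  \<comment> \<open>Strip full periods from either index until both lie in the fundamental
    rectangle, where \<open>E\<close> is the basis itself.\<close>
  have F_E: "lin_ext F (E i j) = G i j" for i j
  proof (induction "i + j" arbitrary: i j rule: less_induct)
    case less
    consider i' where "i = i' + L1" | j' where "j = j' + L2" | "i < L1" "j < L2"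
      by (metis add.commute le_iff_add not_le)
    then show ?case
    proof cases
      case 1
      then show ?thesis
        using less[of i' j] L_pos by (simp add: E_add_L1 G_add_L1)
    next
      case 2
      then show ?thesis
        using less[of i j'] L_pos by (simp add: E_add_L2 G_add_L2 lin_ext_scale)
    next
      case 3
      then show ?thesis
        by (simp add: ext_basis_eq_ebasis ebasis_def F_def)
    qed
  qed
  \<comment> \<open>Successor indices make all four uniform formulas applicable. The equation for
    \<open>\<mu>3\<close> enters for \<open>X12\<close> and \<open>X22\<close>, that for
    \<open>\<mu>4\<close> only for \<open>X22\<close>.\<close>
  have F_gen_E: "lin_ext F (gen_act \<alpha> \<beta> ?\<mu> g (E (Suc i) (Suc j))) = gen_act \<alpha> \<beta> ?\<nu> g (G (Suc i) (Suc j))"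
    for g i j
  proof (cases g)
    case G11
    have "\<mu>1 * \<beta> ^ Suc j * (s ^ Suc (Suc i) * t ^ Suc j) = s ^ Suc i * t ^ Suc j * (\<nu>1 * \<beta> ^ (Suc j + v))"
      using nz' by (simp add: s_def power_add field_simps)
    then show ?thesis
      by (simp only: G11 gen_act_G11 G_def gen_act_scale lin_ext_scale F_E scale_simps add_Suc)
  next
    case G12
    have "inverse \<mu>2 * \<mu>3 * ?q ^ Suc j * ?p ^ Suc i * (s ^ Suc i * t ^ j)
        = s ^ Suc i * t ^ Suc j * (inverse \<nu>2 * \<nu>3 * ?q ^ Suc (j + v) * ?p ^ Suc (i + u))"
      using nz' unfolding \<mu>3 by (simp add: t_def power_add field_simps)
    then show ?thesis
      by (simp only: G12 gen_act_G12 G_def gen_act_scale lin_ext_scale F_E scale_simps add_Suc)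
  next
    case G21
    have "\<mu>2 * (s ^ Suc i * t ^ Suc (Suc j)) = s ^ Suc i * t ^ Suc j * \<nu>2"
      using nz' by (simp add: t_def field_simps)
    then show ?thesis
      by (simp only: G21 gen_act_G21 G_def gen_act_scale lin_ext_scale F_E scale_simps add_Suc)
  next
    case G22
    \<comment> \<open>Both summands share the factor \<open>?q ^ v\<close>; it matches the
      \<open>\<beta> ^ v\<close> in \<open>s\<close> together with the \<open>v\<close> additional
      powers of \<open>inverse \<alpha>\<close> on the target side.\<close>
    have "\<mu>4 + \<beta> * ?p ^ Suc i * \<mu>3 = ?q ^ v * (\<nu>4 + \<beta> * ?p ^ Suc (i + u) * \<nu>3)"
      unfolding \<mu>3 \<mu>4 by (simp add: power_add distrib_left mult_ac del: inverse_mult_distrib)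
    moreover have "inverse \<mu>1 * inverse \<alpha> ^ Suc j * (?q ^ v * x) * (s ^ i * t ^ Suc j)
        = s ^ Suc i * t ^ Suc j * (inverse \<nu>1 * inverse \<alpha> ^ Suc (j + v) * x)" for x
      using nz' nz by (simp add: s_def power_add power_mult_distrib field_simps)
    ultimately show ?thesis
      by (simp only: G22 gen_act_G22 G_def gen_act_scale lin_ext_scale F_E scale_simps add_Suc)
  qed
  have F_gen: "lin_ext F (gen_act \<alpha> \<beta> ?\<mu> g w) = gen_act \<alpha> \<beta> ?\<nu> g (lin_ext F w)"
    if w: "w \<in> carrier (V1 \<alpha> \<beta> ?\<mu>)" for w g
    unfolding gen_act_def lin_ext_lin_ext
  proof (rule lin_ext_cong)
    fix x assume "x \<in> Poly_Mapping.keys w"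
    then obtain a b where x: "x = (a, b)" "a < L1" "b < L2"
      using w by (cases x) (auto simp: carrier_V1)
    obtain c i j where e: "ebasis a b = scale c (E (Suc i) (Suc j))"
      using x by (rule_tac ebasis_eq_E_Suc)
    have F: "F x = scale c (G (Suc i) (Suc j))"
      using e[THEN arg_cong, of "lin_ext F"] x by (simp add: F_E lin_ext_scale ebasis_def)
    have "lin_ext F (basis_act \<alpha> \<beta> ?\<mu> g x) = scale c (lin_ext F (gen_act \<alpha> \<beta> ?\<mu> g (E (Suc i) (Suc j))))"
      unfolding x(1) gen_act_ebasis[symmetric] e gen_act_scale lin_ext_scale ..
    also have "\<dots> = gen_act \<alpha> \<beta> ?\<nu> g (F x)"
      unfolding F gen_act_scale F_gen_E ..
    finally show "lin_ext F (basis_act \<alpha> \<beta> ?\<mu> g x) = lin_ext (basis_act \<alpha> \<beta> ?\<nu> g) (F x)"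
      unfolding gen_act_def .
  qed
  \<comment> \<open>On the basis \<open>F\<close> is monomial: a cyclic shift in each coordinate
    with nonzero weights, hence invertible.\<close>
  have "F = (\<lambda>i. Poly_Mapping.single (map_prod (\<lambda>a. (a + u) mod L1) (\<lambda>b. (b + v) mod L2) i)
      (s ^ fst i * t ^ snd i * inverse \<beta> ^ ((fst i + u) * L2 * ((snd i + v) div L2))))"
    by (simp add: F_def G_def ext_basis_def ebasis_def fun_eq_iff)
  moreover have "s \<noteq> 0" "t \<noteq> 0"
    using nz' nz by (simp_all add: s_def t_def)
  ultimately have bij: "bij_betw (lin_ext F) (carrier (V1 \<alpha> \<beta> ?\<mu>)) (carrier (V1 \<alpha> \<beta> ?\<nu>))"
    unfolding carrier_V1
    by (simp add: bij_betw_lin_ext_monomial bij_betw_map_prod bij_betw_add_mod nz)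
  then have "lin_ext F \<in> carrier (V1 \<alpha> \<beta> ?\<mu>) \<rightarrow> carrier (V1 \<alpha> \<beta> ?\<nu>)"
    by (auto simp: bij_betw_def)
  moreover have "lin_ext F (ract (V1 \<alpha> \<beta> ?\<mu>) w r) = ract (V1 \<alpha> \<beta> ?\<nu>) (lin_ext F w) r"
    if w: "w \<in> carrier (V1 \<alpha> \<beta> ?\<mu>)" and "r \<in> carrier (qmat \<alpha> \<beta>)" for w r
  proof -
    obtain f where r: "r = qmat_class \<alpha> \<beta> f"
      using \<open>r \<in> _\<close> by (auto simp: carrier_qmat)
    have "lin_ext F w \<in> carrier (V1 \<alpha> \<beta> ?\<nu>)"
      using w bij by (auto simp: bij_betw_def)
    then show ?thesis
      using w F_gen unfolding r
      by (simp only: V1_ract_coset[OF \<alpha> \<beta> nz'(1,2)] V1_ract_coset[OF \<alpha> \<beta> nz'(3,4)]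
          free_act_intertwine[of \<alpha> \<beta> ?\<mu> F ?\<nu>])
  qed
  ultimately have "lin_ext F \<in> rmodule_hom (qmat \<alpha> \<beta>) (V1 \<alpha> \<beta> ?\<mu>) (V1 \<alpha> \<beta> ?\<nu>)"
    by (simp add: rmodule_hom_def lin_ext_add)
  then show ?thesis
    using bij by (auto simp: rmodule_isomorphic_def)
qed

end

section \<open>The criterion with integer exponents\<close>

theorem theorem7p1:
  fixes \<alpha> \<beta> \<mu>1 \<mu>2 \<mu>3 \<mu>4 \<nu>1 \<nu>2 \<nu>3 \<nu>4 :: "'k::alg_closed_field"
  assumes "\<alpha> \<noteq> 0" "\<beta> \<noteq> 0"
    and "root_of_unity \<alpha>" "root_of_unity \<beta>"
    and "\<alpha> * \<beta> \<noteq> 1"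
    and "\<mu>1 \<noteq> 0" "\<mu>2 \<noteq> 0" "\<mu>3 \<noteq> 0" "\<mu>4 \<noteq> 0"
    and "\<nu>1 \<noteq> 0" "\<nu>2 \<noteq> 0" "\<nu>3 \<noteq> 0" "\<nu>4 \<noteq> 0"
  shows "rmodule_isomorphic (qmat \<alpha> \<beta>) (V1 \<alpha> \<beta> (\<mu>1, \<mu>2, \<mu>3, \<mu>4)) (V1 \<alpha> \<beta> (\<nu>1, \<nu>2, \<nu>3, \<nu>4)) \<longleftrightarrow>
    (\<exists>u v :: int. 0 \<le> u \<and> u \<le> int (l1 \<alpha> \<beta>) - 1 \<and> 0 \<le> v \<and> v \<le> int (l2 \<alpha> \<beta>) - 1 \<and>
       \<mu>1 ^ l1 \<alpha> \<beta> = \<nu>1 ^ l1 \<alpha> \<beta> * \<beta> powi (v * int (l1 \<alpha> \<beta>)) \<and>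
       \<mu>2 ^ l2 \<alpha> \<beta> = \<nu>2 ^ l2 \<alpha> \<beta> * \<beta> powi (- u * int (l2 \<alpha> \<beta>)) \<and>
       \<mu>3 = \<nu>3 * (\<alpha> * \<beta>) powi (- u) * (inverse \<alpha> * \<beta>) powi v \<and>
       \<mu>4 = \<nu>4 * (inverse \<alpha> * \<beta>) powi v)"
    (is "_ \<longleftrightarrow> (\<exists>u v. ?linked u v)")
proof -
  interpret unit_roots \<alpha> \<beta>
    by standard fact+
  have linked_iff: "?linked (int u) (int v) \<longleftrightarrow> u < l1 \<alpha> \<beta> \<and> v < l2 \<alpha> \<beta> \<and>
      linked_params \<alpha> \<beta> (\<mu>1, \<mu>2, \<mu>3, \<mu>4) (\<nu>1, \<nu>2, \<nu>3, \<nu>4) u v" for u v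
  proof -
    have "\<beta> powi (int v * int (l1 \<alpha> \<beta>)) = \<beta> ^ (v * l1 \<alpha> \<beta>)"
      by (simp only: of_nat_mult[symmetric] power_int_of_nat)
    moreover have "\<beta> powi (- int u * int (l2 \<alpha> \<beta>)) = inverse \<beta> ^ (u * l2 \<alpha> \<beta>)"
      by (simp only: of_nat_mult[symmetric] mult_minus_left power_int_minus power_int_of_nat power_inverse)
    moreover have "\<nu>3 * (\<alpha> * \<beta>) powi (- int u) * (inverse \<alpha> * \<beta>) powi int v
        = \<nu>3 * (inverse \<alpha> * \<beta>) ^ v * inverse (\<alpha> * \<beta>) ^ u"
      by (simp only: power_int_minus power_int_of_nat power_inverse mult_ac)
    moreover have "int u \<le> int (l1 \<alpha> \<beta>) - 1 \<longleftrightarrow> u < l1 \<alpha> \<beta>" "int v \<le> int (l2 \<alpha> \<beta>) - 1 \<longleftrightarrow> v < l2 \<alpha> \<beta>"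
      by linarith+
    ultimately show ?thesis
      by (simp only: linked_params_def prod.case power_int_of_nat of_nat_0_le_iff simp_thms)
  qed
  show ?thesis
  proof
    assume "rmodule_isomorphic (qmat \<alpha> \<beta>) (V1 \<alpha> \<beta> (\<mu>1, \<mu>2, \<mu>3, \<mu>4)) (V1 \<alpha> \<beta> (\<nu>1, \<nu>2, \<nu>3, \<nu>4))"
    then obtain u v where "u < l1 \<alpha> \<beta>" "v < l2 \<alpha> \<beta>"
      "linked_params \<alpha> \<beta> (\<mu>1, \<mu>2, \<mu>3, \<mu>4) (\<nu>1, \<nu>2, \<nu>3, \<nu>4) u v"
      using isomorphic_imp_linked assms(6,7,10,11) by blast
    then have "?linked (int u) (int v)"
      unfolding linked_iff by (intro conjI)
    then show "\<exists>u v. ?linked u v"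
      by (intro exI)
  next
    assume "\<exists>u v. ?linked u v"
    then obtain u v where uv: "?linked u v"
      by (elim exE)
    \<comment> \<open>The lower bounds make both shifts images of natural numbers, so the criterion
      with natural exponents applies.\<close>
    moreover from uv obtain m n where "u = int m" "v = int n"
      by (elim conjE nonneg_int_cases)
    ultimately have "?linked (int m) (int n)"
      by (simp only:)
    then have "linked_params \<alpha> \<beta> (\<mu>1, \<mu>2, \<mu>3, \<mu>4) (\<nu>1, \<nu>2, \<nu>3, \<nu>4) m n"
      unfolding linked_iff by (elim conjE)
    then show "rmodule_isomorphic (qmat \<alpha> \<beta>) (V1 \<alpha> \<beta> (\<mu>1, \<mu>2, \<mu>3, \<mu>4)) (V1 \<alpha> \<beta> (\<nu>1, \<nu>2, \<nu>3, \<nu>4))"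
      by (rule linked_imp_isomorphic[OF assms(6,7,10,11)])
  qed
qed

end
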